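(* Let $K$ be a compact set in $\mathbb{C}^k$, contained in a ball $B$. Assume $x\in\widehat K_\Gamma$. Let $\mu_x$ be a Jensen measure on $K$ representing $x$ for $\mathcal P_\Gamma$. Then there is a positive $\Gamma$-directed current $T_x$ of bidimension $(1,1)$, with support in $\overline B$, such that $$i\partial\overline\partial T_x=\mu_x-\delta_x .$$ In particular, for every $\varphi\in\mathcal P_\Gamma$ we have Jensen's formula $$\int\varphi\,d\mu_x=\varphi(x)+\langle T_x,i\partial\overline\partial\varphi\rangle .$$
   Context: For every $z\in\mathbb{C}^k$, $\Gamma_z$ is a closed cone of $(1,0)$-vectors at $z$ containing non-zero vectors, and $\Gamma:=\bigcup_{z}\Gamma_z$ is closed (in the $(1,0)$-tangent bundle). Define $$\mathcal P_\Gamma:=\{u\in\mathcal C^2(\mathbb{C}^k):\ \langle i\partial\overline\partial u(z), i\xi_z\wedge\bar\xi_z\rangle\ge 0\ \text{for every } z \text{ and every } \xi_z\in\Gamma_z\}.$$ A positive current $T$ of bidimension $(1,1)$ is $\Gamma$-directed if $T\wedge i\partial\overline\partial u\ge0$ for every $u\in\mathcal P_\Gamma$. The hull of a compact $K$ is $$\widehat K_\Gamma:=\{z\in\mathbb{C}^k:\ u(z)\le\sup_K u\ \text{for every } u\in\mathcal P_\Gamma\}.$$ A Jensen measure on $K$ representing $x$ for $\mathcal P_\Gamma$ is a probability measure $\mu_x$ supported on $K$ with $\varphi(x)\le\int\varphi\,d\mu_x$ for every $\varphi\in\mathcal P_\Gamma$. $\delta_x$ is the Dirac mass at $x$. *)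

theory Defs
  imports "HOL-Analysis.Analysis" "HOL-Probability.Probability"
begin

section \<open>Differentiability classes and test functions\<close>

text \<open>Iterated directional derivative of \<open>f\<close>, first along the head of the list.\<close>

fun dird :: "'a list \<Rightarrow> ('a::euclidean_space \<Rightarrow> 'b::real_normed_vector) \<Rightarrow> 'a \<Rightarrow> 'b" where
  "dird [] f = f"
| "dird (v # vs) f = dird vs (\<lambda>z. frechet_derivative f (at z) v)"

text \<open>\<open>f\<close> is of class \<open>C\<^sup>m\<close> on the whole space (real differentiability).\<close>

definition class_C :: "nat \<Rightarrow> ('a::euclidean_space \<Rightarrow> 'b::real_normed_vector) \<Rightarrow> bool" where
  "class_C m f \<longleftrightarrow>
     (\<forall>vs. length vs < m \<longrightarrow> (\<forall>z. dird vs f differentiable (at z))) \<and>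
     (\<forall>vs. length vs \<le> m \<longrightarrow> continuous_on UNIV (dird vs f))"

definition supp :: "('a::topological_space \<Rightarrow> 'b::zero) \<Rightarrow> 'a set" where
  "supp f = closure {z. f z \<noteq> 0}"

definition test :: "('a::euclidean_space \<Rightarrow> 'b::real_normed_vector) \<Rightarrow> bool" where
  "test f \<longleftrightarrow> (\<forall>m. class_C m f) \<and> compact (supp f)"

text \<open>Convergence to \<open>0\<close> in the space of test functions (or test forms).\<close>

definition test_null_seq ::
    "(nat \<Rightarrow> 'a::euclidean_space \<Rightarrow> 'b::real_normed_vector) \<Rightarrow> bool" where
  "test_null_seq \<Phi> \<longleftrightarrow>
     (\<forall>n. test (\<Phi> n)) \<and>
     (\<exists>L. compact L \<and> (\<forall>n. supp (\<Phi> n) \<subseteq> L)) \<and>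
     (\<forall>vs. uniform_limit UNIV (\<lambda>n. dird vs (\<Phi> n)) (\<lambda>_. 0) sequentially)"


section \<open>Forms of bidegree (1,1)\<close>

text \<open>
  The matrix field \<open>\<omega>\<close> stands for the form \<open>\<Sum>\<^sub>j\<^sub>l \<omega>\<^sub>j\<^sub>l i dz\<^sub>j \<and> d(cnj z\<^sub>l)\<close> on \<open>\<complex>\<^sup>k\<close>,
  where \<open>k = CARD('n)\<close>.  A (1,0)-vector \<open>\<Sum>\<^sub>j \<xi>\<^sub>j \<partial>/\<partial>z\<^sub>j\<close> is given by its coefficients.
\<close>

type_synonym 'n form11 = "complex^'n \<Rightarrow> complex^'n^'n"

definition scale_form :: "(complex^'n \<Rightarrow> complex) \<Rightarrow> 'n::finite form11 \<Rightarrow> 'n form11" where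
  "scale_form f \<omega> = (\<lambda>z. \<chi> j l. f z * \<omega> z $ j $ l)"

text \<open>
  The pairing of a (1,1)-form at a point with the bivector \<open>i \<xi> \<and> cnj \<xi>\<close>, with the customary
  normalisation in which \<open>i dz \<and> d(cnj z)\<close> is positive; for \<open>i\<partial>\<partial>bar u\<close> this is the Levi form of \<open>u\<close>.
\<close>

definition pair11 :: "complex^'n^'n \<Rightarrow> complex^'n::finite \<Rightarrow> complex" where
  "pair11 A \<xi> = (\<Sum>j\<in>UNIV. \<Sum>l\<in>UNIV. A $ j $ l * \<xi> $ j * cnj (\<xi> $ l))"

definition positive_form :: "'n::finite form11 \<Rightarrow> bool" where
  "positive_form \<omega> \<longleftrightarrow> (\<forall>z \<xi>. pair11 (\<omega> z) \<xi> \<in> \<real>\<^sub>\<ge>\<^sub>0)"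

text \<open>The Wirtinger operators \<open>\<partial>/\<partial>z\<^sub>j\<close> and \<open>\<partial>/\<partial>(cnj z\<^sub>j)\<close>.\<close>

definition dz :: "'n \<Rightarrow> (complex^'n \<Rightarrow> complex) \<Rightarrow> complex^'n::finite \<Rightarrow> complex" where
  "dz j f z = (frechet_derivative f (at z) (axis j 1)
                - \<i> * frechet_derivative f (at z) (axis j \<i>)) / 2"

definition dzbar :: "'n \<Rightarrow> (complex^'n \<Rightarrow> complex) \<Rightarrow> complex^'n::finite \<Rightarrow> complex" where
  "dzbar j f z = (frechet_derivative f (at z) (axis j 1)
                + \<i> * frechet_derivative f (at z) (axis j \<i>)) / 2"

text \<open>The form \<open>i\<partial>\<partial>bar f\<close>.\<close>

definition iddbar :: "(complex^'n \<Rightarrow> complex) \<Rightarrow> 'n::finite form11" where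
  "iddbar f = (\<lambda>z. \<chi> j l. dz j (dzbar l f) z)"

abbreviation iddbar_real :: "(complex^'n \<Rightarrow> real) \<Rightarrow> 'n::finite form11" where
  "iddbar_real u \<equiv> iddbar (\<lambda>z. complex_of_real (u z))"


section \<open>Currents of bidimension (1,1)\<close>

text \<open>
  Currents are continuous linear functionals on smooth compactly supported (1,1)-forms; the value
  of the function \<open>T\<close> on anything that is not a test form is irrelevant.
\<close>

definition current11 :: "('n::finite form11 \<Rightarrow> complex) \<Rightarrow> bool" where
  "current11 T \<longleftrightarrow>
     (\<forall>\<omega> \<eta>. test \<omega> \<longrightarrow> test \<eta> \<longrightarrow> T (\<lambda>z. \<omega> z + \<eta> z) = T \<omega> + T \<eta>) \<and>
     (\<forall>c \<omega>. test \<omega> \<longrightarrow> T (scale_form (\<lambda>_. c) \<omega>) = c * T \<omega>) \<and>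
     (\<forall>\<Phi>. test_null_seq \<Phi> \<longrightarrow> (\<lambda>n. T (\<Phi> n)) \<longlonglongrightarrow> 0)"

definition positive_current11 :: "('n::finite form11 \<Rightarrow> complex) \<Rightarrow> bool" where
  "positive_current11 T \<longleftrightarrow>
     current11 T \<and> (\<forall>\<omega>. test \<omega> \<longrightarrow> positive_form \<omega> \<longrightarrow> T \<omega> \<in> \<real>\<^sub>\<ge>\<^sub>0)"

definition current_supp :: "('n::finite form11 \<Rightarrow> complex) \<Rightarrow> (complex^'n) set" where
  "current_supp T = - \<Union>{U. open U \<and> (\<forall>\<omega>. test \<omega> \<longrightarrow> supp \<omega> \<subseteq> U \<longrightarrow> T \<omega> = 0)}"

text \<open>
  Positive currents have order 0, so they extend uniquely to continuous compactly supported forms.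
  The extension is the limit of \<open>T\<close> along test forms that converge uniformly with supports
  in a common compact set.
\<close>

definition current_ext :: "('n::finite form11 \<Rightarrow> complex) \<Rightarrow> 'n form11 \<Rightarrow> complex" where
  "current_ext T \<omega> = (THE c. \<forall>\<Phi>.
     (\<forall>n. test (\<Phi> n)) \<longrightarrow>
     (\<exists>L. compact L \<and> (\<forall>n. supp (\<Phi> n) \<subseteq> L)) \<longrightarrow>
     uniform_limit UNIV \<Phi> \<omega> sequentially \<longrightarrow>
     (\<lambda>n. T (\<Phi> n)) \<longlonglongrightarrow> c)"

text \<open>
  The pairing \<open>\<langle>T, \<omega>\<rangle>\<close> of an order 0 current of compact support with a continuous form
  \<open>\<omega>\<close> of arbitrary support, by means of any cut-off function equal to 1 near the support of \<open>T\<close>.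
\<close>

definition current_pairing :: "('n::finite form11 \<Rightarrow> complex) \<Rightarrow> 'n form11 \<Rightarrow> complex" where
  "current_pairing T \<omega> = (THE c. \<forall>f.
     test f \<longrightarrow> (\<exists>U. open U \<and> current_supp T \<subseteq> U \<and> (\<forall>z\<in>U. f z = 1)) \<longrightarrow>
     current_ext T (scale_form f \<omega>) = c)"

text \<open>\<open>T \<and> \<omega>\<close> for an order 0 current \<open>T\<close> and a continuous form \<open>\<omega>\<close>, as a functional on functions.\<close>

definition current_wedge ::
    "('n::finite form11 \<Rightarrow> complex) \<Rightarrow> 'n form11 \<Rightarrow> (complex^'n \<Rightarrow> complex) \<Rightarrow> complex" where
  "current_wedge T \<omega> f = current_ext T (scale_form f \<omega>)"

definition positive_distribution :: "((complex^'n::finite \<Rightarrow> complex) \<Rightarrow> complex) \<Rightarrow> bool" where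
  "positive_distribution S \<longleftrightarrow> (\<forall>f. test f \<longrightarrow> (\<forall>z. f z \<in> \<real>\<^sub>\<ge>\<^sub>0) \<longrightarrow> S f \<in> \<real>\<^sub>\<ge>\<^sub>0)"

text \<open>The current \<open>i\<partial>\<partial>bar T\<close> of bidimension (0,0), acting on test functions.\<close>

definition iddbar_current ::
    "('n::finite form11 \<Rightarrow> complex) \<Rightarrow> (complex^'n \<Rightarrow> complex) \<Rightarrow> complex" where
  "iddbar_current T f = T (iddbar f)"


section \<open>Directed currents, hulls and Jensen measures\<close>

text \<open>\<open>cone\<close> only asks for stability under real factors \<open>c \<ge> 0\<close>; complex cones are included.\<close>

definition cone_field :: "(complex^'n \<Rightarrow> (complex^'n::finite) set) \<Rightarrow> bool" where
  "cone_field \<Gamma> \<longleftrightarrow>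
     (\<forall>z. closed (\<Gamma> z) \<and> cone (\<Gamma> z) \<and> (\<exists>\<xi>\<in>\<Gamma> z. \<xi> \<noteq> 0)) \<and>
     closed {(z, \<xi>). \<xi> \<in> \<Gamma> z}"

definition P_class ::
    "(complex^'n \<Rightarrow> (complex^'n::finite) set) \<Rightarrow> (complex^'n \<Rightarrow> real) set" where
  "P_class \<Gamma> = {u. class_C 2 u \<and> (\<forall>z. \<forall>\<xi>\<in>\<Gamma> z. pair11 (iddbar_real u z) \<xi> \<in> \<real>\<^sub>\<ge>\<^sub>0)}"

definition directed_current ::
    "(complex^'n \<Rightarrow> (complex^'n::finite) set) \<Rightarrow> ('n form11 \<Rightarrow> complex) \<Rightarrow> bool" where
  "directed_current \<Gamma> T \<longleftrightarrow>
     positive_current11 T \<and>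
     (\<forall>u\<in>P_class \<Gamma>. positive_distribution (current_wedge T (iddbar_real u)))"

text \<open>The supremum is taken in the extended reals, so that the hull of the empty set is empty.\<close>

definition hull_P ::
    "(complex^'n \<Rightarrow> (complex^'n::finite) set) \<Rightarrow> (complex^'n) set \<Rightarrow> (complex^'n) set" where
  "hull_P \<Gamma> K = {z. \<forall>u\<in>P_class \<Gamma>. ereal (u z) \<le> (SUP w\<in>K. ereal (u w))}"

definition jensen_measure ::
    "(complex^'n \<Rightarrow> (complex^'n::finite) set) \<Rightarrow> (complex^'n) set \<Rightarrow> complex^'n
      \<Rightarrow> (complex^'n) measure \<Rightarrow> bool" where
  "jensen_measure \<Gamma> K x \<mu> \<longleftrightarrow>
     prob_space \<mu> \<and> sets \<mu> = sets borel \<and> emeasure \<mu> (- K) = 0 \<and>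
     (\<forall>u\<in>P_class \<Gamma>. u x \<le> (LINT z|\<mu>. u z))"

end

theory Submission
  imports Defs "HOL-Computational_Algebra.Polynomial"
begin

text \<open>
  On the set \<open>S\<close> of unit vectors of \<open>\<Gamma>\<close> over the closed ball, let \<open>Lu\<close> be the Levi form of a
  \<open>C\<^sup>2\<close> function \<open>u\<close>.  The functional \<open>Lu \<mapsto> \<integral>u d\<mu> - u(x)\<close> is positive: if \<open>Lu \<ge> 0\<close> on \<open>S\<close>, then \<open>u\<close>
  agrees on \<open>K\<close> and at \<open>x\<close> with an element of \<open>\<P>\<^sub>\<Gamma>\<close>, obtained by cutting \<open>u\<close> off and adding a large
  multiple of \<open>max(0, |z - c|\<^sup>2 - a)\<^sup>3\<close>, and the Jensen property applies.  Since \<open>L|z - c|\<^sup>2 = 1\<close> on \<open>S\<close>,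
  the functional extends to a positive functional \<open>\<Lambda>\<close> on all bounded functions on \<open>S\<close>, and
  \<open>T(\<omega>) = \<Lambda>(\<langle>\<omega>, i\<xi> \<and> cnj \<xi>\<rangle>)\<close> is the current.
\<close>

section \<open>Functions of class C^m\<close>

text \<open>Jensen's formula concerns functions that are only of class C^2, while a current is given
  on smooth compactly supported forms. So the current is defined by one formula on all continuous
  forms, and the definite descriptions \<open>current_ext\<close> and \<open>current_pairing\<close>
  are then shown to return that formula. The tool is the bound of |\<Lambda> g| by \<Lambda>(1)
  times the supremum of |g| over S: it turns uniform convergence of forms into convergence of
  values, with no topology or measurability on S. The delicate point is positivity: a nonnegative
  Levi form over the ball says nothing outside it, whereas the class asks for nonnegativity
  everywhere. The correction must vanish on K and at x and yet be steep enough from the sphere |z -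
  c| = r outwards. There is room for this because the compact K lies in a sublevel |z - c|^2 \<le> a
  with a < r^2, and x lies in it too, since |z - c|^2 itself belongs to the class and tests
  membership in the hull.\<close>

lemma class_C_0: "class_C 0 f \<longleftrightarrow> continuous_on UNIV f"
  by (auto simp: class_C_def)

lemma class_C_Suc:
  "class_C (Suc m) f \<longleftrightarrow>
     (\<forall>z. f differentiable (at z)) \<and> (\<forall>v. class_C m (\<lambda>z. frechet_derivative f (at z) v))"
proof
  assume f: "class_C (Suc m) f"
  have "f differentiable (at z)" for z
    using f unfolding class_C_def by (metis dird.simps(1) list.size(3) zero_less_Suc)
  moreover have "class_C m (\<lambda>z. frechet_derivative f (at z) v)" for v
    unfolding class_C_def
  proof (intro conjI allI impI)
    fix vs :: "'a list" and z assume "length vs < m"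
    then show "dird vs (\<lambda>z. frechet_derivative f (at z) v) differentiable at z"
      using f[unfolded class_C_def, THEN conjunct1, rule_format, of "v # vs" z] by simp
  next
    fix vs :: "'a list" assume "length vs \<le> m"
    then show "continuous_on UNIV (dird vs (\<lambda>z. frechet_derivative f (at z) v))"
      using f[unfolded class_C_def, THEN conjunct2, rule_format, of "v # vs"] by simp
  qed
  ultimately show "(\<forall>z. f differentiable (at z)) \<and> (\<forall>v. class_C m (\<lambda>z. frechet_derivative f (at z) v))"
    by blast
next
  assume f: "(\<forall>z. f differentiable (at z)) \<and> (\<forall>v. class_C m (\<lambda>z. frechet_derivative f (at z) v))"
  then have "continuous_on UNIV f"
    by (simp add: continuous_at_imp_continuous_on differentiable_imp_continuous_within)
  with f show "class_C (Suc m) f"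
    unfolding class_C_def
    apply (intro conjI allI impI)
    subgoal for vs z by (cases vs) auto
    subgoal for vs by (cases vs) auto
    done
qed

text \<open>Uniqueness of the derivative identifies any explicit candidate with
  \<open>frechet_derivative\<close>, so the closure properties below follow by induction on m from
  the usual differentiation rules.\<close>

lemma class_C_SucI:
  assumes "\<And>z. (f has_derivative f' z) (at z)" "\<And>v. class_C m (\<lambda>z. f' z v)"
  shows "class_C (Suc m) f"
proof -
  have "frechet_derivative f (at z) = f' z" for z
    using assms(1) by (metis frechet_derivative_at)
  then show ?thesis
    using assms by (auto simp: class_C_Suc differentiable_def)
qed

lemma class_C_SucE:
  assumes "class_C (Suc m) f"
  shows "(f has_derivative frechet_derivative f (at z)) (at z)"
    and "class_C m (\<lambda>z. frechet_derivative f (at z) v)"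
  using assms by (auto simp: class_C_Suc frechet_derivative_works)

lemma class_C_le: "class_C m f \<Longrightarrow> n \<le> m \<Longrightarrow> class_C n f"
  unfolding class_C_def by auto

lemma class_C_continuous: "class_C m f \<Longrightarrow> continuous_on S f"
  using class_C_le[of m f 0] continuous_on_subset by (auto simp: class_C_0)

lemma class_C_const: "class_C m (\<lambda>z. c)"
proof (induction m arbitrary: c)
  case (Suc m)
  show ?case by (rule class_C_SucI[OF has_derivative_const]) (rule Suc)
qed (simp add: class_C_0)

lemma class_C_add: "class_C m f \<Longrightarrow> class_C m g \<Longrightarrow> class_C m (\<lambda>z. f z + g z)"
proof (induction m arbitrary: f g)
  case (Suc m)
  show ?case
    by (rule class_C_SucI[OF has_derivative_add[OF class_C_SucE(1) class_C_SucE(1)]])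
      (auto intro!: Suc class_C_SucE(2))
qed (auto simp: class_C_0 intro: continuous_intros)

lemma class_C_sum: "(\<And>i. i \<in> I \<Longrightarrow> class_C m (f i)) \<Longrightarrow> class_C m (\<lambda>z. \<Sum>i\<in>I. f i z)"
  by (induction I rule: infinite_finite_induct) (auto intro: class_C_const class_C_add)

lemma class_C_bounded_linear_comp:
  "bounded_linear F \<Longrightarrow> class_C m f \<Longrightarrow> class_C m (\<lambda>z. F (f z))"
proof (induction m arbitrary: f)
  case 0 then show ?case by (auto simp: class_C_0 bounded_linear.continuous_on)
next
  case (Suc m)
  show ?case
    by (rule class_C_SucI[OF bounded_linear.has_derivative[OF Suc(2) class_C_SucE(1)]])
      (auto intro!: Suc class_C_SucE(2))
qed

lemma class_C_bounded_linear: "bounded_linear F \<Longrightarrow> class_C m F"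
proof (cases m)
  case 0 assume "bounded_linear F" then show ?thesis using 0 by (auto simp: class_C_0 linear_continuous_on)
next
  case (Suc n) assume "bounded_linear F" 
  then show ?thesis unfolding Suc
    by (intro class_C_SucI[OF bounded_linear_imp_has_derivative] class_C_const)
qed

lemma class_C_ident: "class_C m (\<lambda>z. z)"
  by (intro class_C_bounded_linear bounded_linear_ident)

lemma class_C_bilinear:
  assumes "bounded_bilinear B"
  shows "class_C m f \<Longrightarrow> class_C m g \<Longrightarrow> class_C m (\<lambda>z. B (f z) (g z))"
proof (induction m arbitrary: f g)
  case 0 then show ?case using assms by (auto simp: class_C_0 bounded_bilinear.continuous_on)
next
  case (Suc m)
  show ?case
    by (rule class_C_SucI[OF bounded_bilinear.FDERIV[OF assms class_C_SucE(1) class_C_SucE(1)]])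
      (auto intro!: Suc class_C_add intro: class_C_SucE(2) class_C_le)
qed

lemmas class_C_mult = class_C_bilinear[OF bounded_bilinear_mult]
  and class_C_scaleR = class_C_bilinear[OF bounded_bilinear_scaleR]
  and class_C_inner = class_C_bilinear[OF bounded_bilinear_inner]

lemma class_C_diff: "class_C m f \<Longrightarrow> class_C m g \<Longrightarrow> class_C m (\<lambda>z. f z - g z)"
  for f :: "'a::euclidean_space \<Rightarrow> 'b::real_normed_vector"
  using class_C_add[of m f "\<lambda>z. - g z"] class_C_bounded_linear_comp[OF bounded_linear_minus[OF bounded_linear_ident], of m g] by simp

lemma class_C_inverse:
  fixes f :: "'a::euclidean_space \<Rightarrow> real"
  assumes "\<And>z. f z \<noteq> 0"
  shows "class_C m f \<Longrightarrow> class_C m (\<lambda>z. inverse (f z))"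
proof (induction m)
  case 0 then show ?case using assms by (auto simp: class_C_0 intro: continuous_on_inverse)
next
  case (Suc m)
  have "class_C m (\<lambda>z. inverse (f z))" using Suc.IH class_C_le[OF Suc.prems, of m] by simp
  then have "class_C m (\<lambda>z. - (inverse (f z) * frechet_derivative f (at z) v * inverse (f z)))" for v
    by (intro class_C_bounded_linear_comp[OF bounded_linear_minus[OF bounded_linear_ident]] class_C_mult
        class_C_SucE(2)[OF Suc.prems])
  then show ?case
    by (rule class_C_SucI[OF Deriv.has_derivative_inverse[OF assms class_C_SucE(1)[OF Suc.prems]]])
qed

text \<open>\<open>D n\<close> is the n-th derivative of \<open>D 0\<close>; the chain rule leaves
  \<open>D 1\<close> composed with q, to which the induction applies with the sequence shifted. Only
  derivatives up to order m are required, so the rule covers both the flat exponential and a cubed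
  positive part.\<close>

lemma class_C_compose_real:
  fixes q :: "'a::euclidean_space \<Rightarrow> real" and D :: "nat \<Rightarrow> real \<Rightarrow> real"
  shows "class_C m q \<Longrightarrow> (\<And>n t. n < m \<Longrightarrow> (D n has_real_derivative D (Suc n) t) (at t)) \<Longrightarrow>
    continuous_on UNIV (D m) \<Longrightarrow> class_C m (\<lambda>z. D 0 (q z))"
proof (induction m arbitrary: D)
  case 0 then show ?case by (auto simp: class_C_0 intro: continuous_on_compose2)
next
  case (Suc m)
  have "class_C m (\<lambda>z. D (Suc 0) (q z))"
    using Suc.prems class_C_le[OF Suc.prems(1), of m] by (intro Suc.IH[of "\<lambda>n. D (Suc n)"]) auto
  then have "class_C m (\<lambda>z. D (Suc 0) (q z) * frechet_derivative q (at z) v)" for v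
    by (intro class_C_mult class_C_SucE(2)[OF Suc.prems(1)])
  moreover have "((\<lambda>z. D 0 (q z)) has_derivative (\<lambda>v. D (Suc 0) (q z) * frechet_derivative q (at z) v)) (at z)" for z
    using has_derivative_compose[OF class_C_SucE(1)[OF Suc.prems(1)], of "D 0" "(*) (D (Suc 0) (q z))" z]
      Suc.prems(2)[of 0 "q z"] by (simp add: has_field_derivative_def)
  ultimately show ?case
    by (rule class_C_SucI[rotated])
qed

text \<open>Regularity is assumed up to the length of the list because
  \<open>frechet_derivative\<close> is an arbitrary choice wherever the function is not
  differentiable.\<close>

lemma dird_bounded_linear_comp:
  assumes "bounded_linear F"
  shows "class_C (length vs) f \<Longrightarrow> dird vs (\<lambda>z. F (f z)) = (\<lambda>z. F (dird vs f z))"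
proof (induction vs arbitrary: f)
  case (Cons v vs)
  then have f: "class_C (Suc (length vs)) f" by simp
  have "frechet_derivative (\<lambda>z. F (f z)) (at z) = (\<lambda>v. F (frechet_derivative f (at z) v))" for z
    using frechet_derivative_at[OF bounded_linear.has_derivative[OF assms class_C_SucE(1)[OF f]]] by simp
  then show ?case using Cons.IH[OF class_C_SucE(2)[OF f]] by simp
qed simp

lemma dird_add:
  "class_C (length vs) f \<Longrightarrow> class_C (length vs) g \<Longrightarrow>
    dird vs (\<lambda>z. f z + g z) = (\<lambda>z. dird vs f z + dird vs g z)"
proof (induction vs arbitrary: f g)
  case (Cons v vs)
  then have f: "class_C (Suc (length vs)) f" and g: "class_C (Suc (length vs)) g" by simp_all
  have "frechet_derivative (\<lambda>z. f z + g z) (at z)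
     = (\<lambda>v. frechet_derivative f (at z) v + frechet_derivative g (at z) v)" for z
    using frechet_derivative_at[OF has_derivative_add[OF class_C_SucE(1)[OF f] class_C_SucE(1)[OF g]]] by simp
  then show ?case using Cons.IH[OF class_C_SucE(2)[OF f] class_C_SucE(2)[OF g]] by simp
qed simp

lemma class_C_polynomial_function:
  fixes p :: "'a::euclidean_space \<Rightarrow> 'b::euclidean_space"
  assumes "polynomial_function p" shows "class_C m p"
proof -
  have real: "class_C m f" if "real_polynomial_function f" for f :: "'a \<Rightarrow> real"
    using that by induction (auto intro: class_C_bounded_linear class_C_const class_C_add class_C_mult)
  have "real_polynomial_function (\<lambda>z. p z \<bullet> b)" for b
    using assms bounded_linear_inner_left unfolding polynomial_function_def by (force simp: o_def)
  then have "class_C m (\<lambda>z. \<Sum>b\<in>Basis. (p z \<bullet> b) *\<^sub>R b)"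
    by (intro class_C_sum class_C_scaleR real class_C_const)
  then show ?thesis by (simp add: euclidean_representation)
qed

section \<open>Bump functions and smooth approximation\<close>

text \<open>
  The \<open>n\<close>-th derivative of \<open>exp(-1/t)\<close> is \<open>P(1/t) exp(-1/t)\<close> with \<open>P = flat_poly n\<close>.
\<close>

primrec flat_poly :: "nat \<Rightarrow> real poly" where
  "flat_poly 0 = 1"
| "flat_poly (Suc n) = [:0, 0, 1:] * (flat_poly n - pderiv (flat_poly n))"

definition flat_exp :: "nat \<Rightarrow> real \<Rightarrow> real" where
  "flat_exp n t = (if t > 0 then poly (flat_poly n) (inverse t) * exp (- inverse t) else 0)"

lemma poly_exp_tendsto_0: "((\<lambda>x. poly p x * exp (- x)) \<longlongrightarrow> (0::real)) at_top"
proof -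
  have "((\<lambda>x. \<Sum>i\<le>degree p. coeff p i * (x ^ i / exp x)) \<longlongrightarrow> (\<Sum>i\<le>degree p. coeff p i * 0)) at_top"
    by (intro tendsto_intros tendsto_power_div_exp_0)
  then show ?thesis
    by (simp add: poly_altdef exp_minus sum_distrib_right divide_inverse mult.assoc)
qed

lemma flat_exp_tendsto_0: "((\<lambda>t. poly p (inverse t) * exp (- inverse t)) \<longlongrightarrow> (0::real)) (at_right 0)"
  by (rule filterlim_compose[OF poly_exp_tendsto_0 filterlim_inverse_at_top_right])

lemma has_real_derivative_flat_exp:
  "(flat_exp n has_real_derivative flat_exp (Suc n) t) (at t)"
proof (cases t "0::real" rule: linorder_cases)
  case less
  have "((\<lambda>t. 0) has_real_derivative 0) (at t)" by simp
  then have "(flat_exp n has_real_derivative 0) (at t)"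
    by (rule has_field_derivative_transform_within_open[of _ _ _ "{..<0}"])
      (use less in \<open>auto simp: flat_exp_def\<close>)
  then show ?thesis using less by (simp add: flat_exp_def)
next
  case greater
  have inv: "(inverse has_real_derivative - (inverse t * inverse t)) (at t)"
    using DERIV_inverse[of t] greater by (simp add: numeral_2_eq_2)
  have "((\<lambda>t. poly (flat_poly n) (inverse t)) has_real_derivative
      poly (pderiv (flat_poly n)) (inverse t) * - (inverse t * inverse t)) (at t)"
    by (rule DERIV_chain2[OF poly_DERIV inv])
  moreover have "((\<lambda>t. exp (- inverse t)) has_real_derivative
      exp (- inverse t) * (inverse t * inverse t)) (at t)"
    using DERIV_chain2[OF DERIV_exp DERIV_minus[OF inv]] by simp
  \<comment> \<open>The derivative of P(1/t) exp(-1/t) is t^(-2) (P - P')(1/t) exp(-1/t), which is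
    the recursion of \<open>flat_poly\<close>.\<close>
  ultimately have "((\<lambda>t. poly (flat_poly n) (inverse t) * exp (- inverse t)) has_real_derivative
      poly (flat_poly (Suc n)) (inverse t) * exp (- inverse t)) (at t)"
    by (rule DERIV_cong[OF DERIV_mult]) (simp add: algebra_simps)
  then have "(flat_exp n has_real_derivative poly (flat_poly (Suc n)) (inverse t) * exp (- inverse t)) (at t)"
    by (rule has_field_derivative_transform_within_open[of _ _ _ "{0<..}"])
      (use greater in \<open>auto simp: flat_exp_def\<close>)
  then show ?thesis using greater by (simp add: flat_exp_def)
next
  case equal
  \<comment> \<open>Dividing by y multiplies the polynomial in 1/y by its variable, so the
    difference quotient at 0 is again a polynomial in 1/y times exp(-1/y).\<close>
  have "((\<lambda>y. flat_exp n y / y) \<longlongrightarrow> 0) (at_right 0)"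
    using flat_exp_tendsto_0[of "[:0, 1:] * flat_poly n"]
    by (rule Lim_transform_eventually) (auto simp: eventually_at_filter flat_exp_def field_simps)
  moreover have "((\<lambda>y. flat_exp n y / y) \<longlongrightarrow> 0) (at_left 0)"
    by (rule Lim_transform_eventually[OF tendsto_const]) (auto simp: eventually_at_filter flat_exp_def)
  ultimately have "((\<lambda>y. flat_exp n y / y) \<longlongrightarrow> 0) (at 0)"
    by (simp add: filterlim_at_split)
  then show ?thesis using equal
    by (simp add: has_field_derivative_iff flat_exp_def)
qed

lemma class_C_flat_exp: "class_C m q \<Longrightarrow> class_C m (\<lambda>z. flat_exp 0 (q z))"
  by (rule class_C_compose_real[where D = flat_exp])
    (auto intro: has_real_derivative_flat_exp continuous_at_imp_continuous_on DERIV_isCont)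

lemma flat_exp_pos: "t > 0 \<Longrightarrow> flat_exp 0 t > 0"
  and flat_exp_nonneg: "flat_exp 0 t \<ge> 0"
  and flat_exp_nonpos: "t \<le> 0 \<Longrightarrow> flat_exp 0 t = 0"
  by (auto simp: flat_exp_def)

lemma supp_subset: "closed L \<Longrightarrow> (\<And>z. f z \<noteq> 0 \<Longrightarrow> z \<in> L) \<Longrightarrow> supp f \<subseteq> L"
  unfolding supp_def by (rule closure_minimal) auto

lemma compact_supp:
  fixes L :: "'a::t2_space set"
  assumes "compact L" "\<And>z. f z \<noteq> 0 \<Longrightarrow> z \<in> L"
  shows "compact (supp f)"
proof -
  have "supp f \<subseteq> L"
    by (rule supp_subset[OF compact_imp_closed[OF assms(1)] assms(2)])
  moreover have "compact (L \<inter> supp f)"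
    using assms(1) unfolding supp_def by (intro compact_Int_closed) auto
  ultimately show ?thesis by (simp add: Int_absorb1)
qed

lemma in_supp: "f z \<noteq> 0 \<Longrightarrow> z \<in> supp f"
  unfolding supp_def by (rule subsetD[OF closure_subset]) simp

text \<open>With h(t) = exp(-1/t) for t > 0 and 0 elsewhere, the bump is h(b - q) / (h(b - q) + h(q
  - a)) for q = |z - c|^2. The denominator never vanishes since a < b rules out b \<le> q \<le>
  a.\<close>

lemma bump_exists:
  fixes c :: "'a::euclidean_space"
  assumes "s < r" "0 < r"
  shows "\<exists>\<beta> :: 'a \<Rightarrow> real. test \<beta> \<and> supp \<beta> \<subseteq> cball c r \<and> (\<forall>z\<in>cball c s. \<beta> z = 1)"
proof -
  define q where "q = (\<lambda>z. (z - c) \<bullet> (z - c))"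
  \<comment> \<open>For negative s the inner ball is empty; truncating at 0 keeps a < b in that case
    as well.\<close>
  define a where "a = (max s 0)^2"
  define b where "b = r\<^sup>2"
  have ab: "a < b" unfolding a_def b_def using assms by (intro power_strict_mono) auto
  define den where "den = (\<lambda>z. flat_exp 0 (b - q z) + flat_exp 0 (q z - a))"
  define \<beta> where "\<beta> = (\<lambda>z. flat_exp 0 (b - q z) * inverse (den z))"
  have den: "den z > 0" for z
    using flat_exp_nonneg[of "b - q z"] flat_exp_nonneg[of "q z - a"]
      flat_exp_pos[of "b - q z"] flat_exp_pos[of "q z - a"] ab
    unfolding den_def by (cases "b > q z") (auto simp: add_pos_nonneg add_nonneg_pos)
  have q: "class_C m q" for m
    unfolding q_def by (intro class_C_inner class_C_diff class_C_ident class_C_const)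
  have C: "class_C m \<beta>" for m
    unfolding \<beta>_def
  proof (intro class_C_mult class_C_inverse)
    show "den z \<noteq> 0" for z using den[of z] by simp
    show "class_C m den" unfolding den_def
      by (intro class_C_add class_C_flat_exp class_C_diff class_C_const q)
  qed (intro class_C_flat_exp class_C_diff class_C_const q)
  have qd: "q z = (dist c z)\<^sup>2" for z
    unfolding q_def by (simp add: dot_square_norm dist_norm norm_minus_commute)
  have out: "z \<in> cball c r" if "\<beta> z \<noteq> 0" for z
  proof (rule ccontr)
    assume "z \<notin> cball c r"
    then have "b \<le> q z" unfolding b_def qd using assms by (intro power_mono) auto
    then show False using that by (simp add: \<beta>_def flat_exp_nonpos)
  qed
  show ?thesis
  proof (intro exI conjI)
    show "test \<beta>" unfolding test_def using C compact_supp[OF compact_cball out] by simp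
    show "supp \<beta> \<subseteq> cball c r" by (rule supp_subset[OF closed_cball out])
    show "\<forall>z\<in>cball c s. \<beta> z = 1"
    proof
      fix z assume that: "z \<in> cball c s"
      have "q z \<le> a" unfolding a_def qd using that by (intro power_mono) auto
      then show "\<beta> z = 1" using den[of z] by (simp add: \<beta>_def den_def flat_exp_nonpos)
    qed
  qed
qed

text \<open>Replaces convolution: Stone-Weierstrass gives polynomials close to \<omega> on the
  support of \<beta>, and the factor \<beta> turns them into test functions whose supports lie in
  one compact set.\<close>

lemma smooth_approximation:
  fixes \<omega> :: "'a::euclidean_space \<Rightarrow> 'b::euclidean_space" and \<beta> :: "'a \<Rightarrow> real"
  assumes "test \<beta>" "continuous_on UNIV \<omega>"
  obtains \<Phi> where "\<And>n. test (\<Phi> n)" "\<And>n. supp (\<Phi> n) \<subseteq> supp \<beta>"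
    "uniform_limit UNIV \<Phi> (\<lambda>z. \<beta> z *\<^sub>R \<omega> z) sequentially"
proof -
  have cs: "compact (supp \<beta>)" and C: "class_C m \<beta>" for m using assms(1) by (auto simp: test_def)
  have "compact (\<beta> ` supp \<beta>)"
    using class_C_continuous[OF C[of 0]] cs by (rule compact_continuous_image)
  then have "bounded (\<beta> ` supp \<beta>)" by (rule compact_imp_bounded)
  then obtain M where M: "\<And>z. z \<in> supp \<beta> \<Longrightarrow> norm (\<beta> z) \<le> M"
    unfolding bounded_iff by auto
  define M' where "M' = max M 1"
  have M': "norm (\<beta> z) \<le> M'" for z
    using M[of z] in_supp[of \<beta> z] unfolding M'_def by (cases "\<beta> z = 0") auto
  have M'0: "M' > 0" unfolding M'_def by simp
  have "\<exists>g. polynomial_function g \<and> (\<forall>z\<in>supp \<beta>. norm (\<omega> z - g z) < inverse (Suc n))" for n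
    using Stone_Weierstrass_polynomial_function[OF cs continuous_on_subset[OF assms(2)], of "inverse (Suc n)"]
    by auto
  then obtain g where "\<forall>n. polynomial_function (g n) \<and> (\<forall>z\<in>supp \<beta>. norm (\<omega> z - g n z) < inverse (Suc n))"
    using choice[of "\<lambda>n g. polynomial_function g \<and> (\<forall>z\<in>supp \<beta>. norm (\<omega> z - g z) < inverse (Suc n))"] by blast
  then have g: "\<And>n. polynomial_function (g n)"
    "\<And>n z. z \<in> supp \<beta> \<Longrightarrow> norm (\<omega> z - g n z) < inverse (Suc n)"
    by auto
  define \<Phi> where "\<Phi> = (\<lambda>n z. \<beta> z *\<^sub>R g n z)"
  have nz: "z \<in> supp \<beta>" if "\<Phi> n z \<noteq> 0" for n z
    using that in_supp[of \<beta> z] by (auto simp: \<Phi>_def)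
  have supp: "compact (supp (\<Phi> n)) \<and> supp (\<Phi> n) \<subseteq> supp \<beta>" for n
    by (intro conjI compact_supp[OF cs] supp_subset compact_imp_closed[OF cs]) (erule nz)+
  have smooth: "class_C m (\<Phi> n)" for m n
    unfolding \<Phi>_def by (intro class_C_scaleR C class_C_polynomial_function g(1))
  show ?thesis
  proof
    show "test (\<Phi> n)" for n
      using supp[of n] smooth by (simp add: test_def)
    show "supp (\<Phi> n) \<subseteq> supp \<beta>" for n using supp[of n] by simp
    show "uniform_limit UNIV \<Phi> (\<lambda>z. \<beta> z *\<^sub>R \<omega> z) sequentially"
    proof (rule uniform_limitI)
      fix e :: real assume "e > 0"
      have "\<forall>\<^sub>F n in sequentially. inverse (real (Suc n)) < e / M'"
        by (rule order_tendstoD(2)[OF LIMSEQ_inverse_real_of_nat]) (use \<open>e > 0\<close> M'0 in simp)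
      then show "\<forall>\<^sub>F n in sequentially. \<forall>z\<in>UNIV. dist (\<Phi> n z) (\<beta> z *\<^sub>R \<omega> z) < e"
      proof (eventually_elim, safe)
        fix n z assume n: "inverse (real (Suc n)) < e / M'"
        have d: "dist (\<Phi> n z) (\<beta> z *\<^sub>R \<omega> z) = norm (\<beta> z) * norm (\<omega> z - g n z)"
          by (simp only: \<Phi>_def dist_norm scaleR_diff_right[symmetric] norm_scaleR real_norm_def norm_minus_commute[of "g n z"])
        show "dist (\<Phi> n z) (\<beta> z *\<^sub>R \<omega> z) < e"
        proof (cases "\<beta> z = 0")
          case True then show ?thesis using d \<open>e > 0\<close> by simp
        next
          case False
          then have "norm (\<omega> z - g n z) < inverse (Suc n)" by (intro g(2) in_supp)
          then have "norm (\<beta> z) * norm (\<omega> z - g n z) \<le> M' * inverse (Suc n)"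
            using M'[of z] M'0 by (intro mult_mono) auto
          also have "\<dots> < e" using n M'0 by (simp add: field_simps)
          finally show ?thesis using d by simp
        qed
      qed
    qed
  qed
qed

section \<open>The Levi form\<close>

lemma class_C_line_derivative:
  fixes g :: "'a::euclidean_space \<Rightarrow> real"
  assumes "class_C (Suc m) g"
  shows "((\<lambda>s. g (a + s *\<^sub>R v)) has_real_derivative frechet_derivative g (at (a + s *\<^sub>R v)) v) (at s)"
proof -
  have "((\<lambda>s. a + s *\<^sub>R v) has_derivative (\<lambda>s. s *\<^sub>R v)) (at s)"
    by (auto intro!: derivative_eq_intros)
  from has_derivative_compose[OF this class_C_SucE(1)[OF assms]]
  have d: "((\<lambda>s. g (a + s *\<^sub>R v)) has_derivative (\<lambda>t. frechet_derivative g (at (a + s *\<^sub>R v)) (t *\<^sub>R v))) (at s)" .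
  have "linear (frechet_derivative g (at (a + s *\<^sub>R v)))"
    by (rule has_derivative_linear[OF class_C_SucE(1)[OF assms]])
  then have "(\<lambda>t. frechet_derivative g (at (a + s *\<^sub>R v)) (t *\<^sub>R v)) = (*) (frechet_derivative g (at (a + s *\<^sub>R v)) v)"
    by (intro ext) (simp only: linear_scale real_scaleR_def mult.commute)
  then show ?thesis using d unfolding has_field_derivative_def by (simp only:)
qed

text \<open>The mean value theorem is applied twice, along v to the difference in direction w, then
  along w to the derivative. The left side is symmetric in v and w although the right side is not
  visibly so.\<close>

lemma second_difference:
  fixes f :: "'a::euclidean_space \<Rightarrow> real"
  assumes f: "class_C 2 f" and t: "t > 0"
  shows "\<exists>p. dist p z \<le> t * (norm v + norm w) \<and>
    f (z + t *\<^sub>R v + t *\<^sub>R w) - f (z + t *\<^sub>R v) - f (z + t *\<^sub>R w) + f z = t\<^sup>2 * dird [v, w] f p"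
proof -
  note f2 = f[unfolded numeral_2_eq_2]
  define D where "D = (\<lambda>y. frechet_derivative f (at y) v)"
  have D: "class_C (Suc 0) D" unfolding D_def using class_C_SucE(2)[OF f2] .
  define \<phi> where "\<phi> = (\<lambda>s. f ((z + t *\<^sub>R w) + s *\<^sub>R v) - f (z + s *\<^sub>R v))"
  have "(\<phi> has_real_derivative (D ((z + t *\<^sub>R w) + s *\<^sub>R v) - D (z + s *\<^sub>R v))) (at s)" for s
    unfolding \<phi>_def D_def by (intro DERIV_diff class_C_line_derivative[OF f2])
  then obtain s where s: "0 < s" "s < t"
    and 1: "\<phi> t - \<phi> 0 = (t - 0) * (D ((z + t *\<^sub>R w) + s *\<^sub>R v) - D (z + s *\<^sub>R v))"
    using MVT2[OF t, of \<phi> "\<lambda>s. D ((z + t *\<^sub>R w) + s *\<^sub>R v) - D (z + s *\<^sub>R v)"] by blast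
  have "((\<lambda>\<tau>. D ((z + s *\<^sub>R v) + \<tau> *\<^sub>R w)) has_real_derivative
      frechet_derivative D (at ((z + s *\<^sub>R v) + \<tau> *\<^sub>R w)) w) (at \<tau>)" for \<tau>
    by (rule class_C_line_derivative[OF D])
  then obtain \<tau> where \<tau>: "0 < \<tau>" "\<tau> < t"
    and 2: "D ((z + s *\<^sub>R v) + t *\<^sub>R w) - D ((z + s *\<^sub>R v) + 0 *\<^sub>R w)
      = (t - 0) * frechet_derivative D (at ((z + s *\<^sub>R v) + \<tau> *\<^sub>R w)) w"
    using MVT2[OF t, of "\<lambda>\<tau>. D ((z + s *\<^sub>R v) + \<tau> *\<^sub>R w)"
      "\<lambda>\<tau>. frechet_derivative D (at ((z + s *\<^sub>R v) + \<tau> *\<^sub>R w)) w"] by blast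
  define p where "p = z + s *\<^sub>R v + \<tau> *\<^sub>R w"
  have "\<phi> t - \<phi> 0 = t * (t * frechet_derivative D (at p) w)"
    using 1 2 by (simp add: p_def algebra_simps)
  moreover have "\<phi> t - \<phi> 0 = f (z + t *\<^sub>R v + t *\<^sub>R w) - f (z + t *\<^sub>R v) - f (z + t *\<^sub>R w) + f z"
    by (simp add: \<phi>_def algebra_simps)
  moreover have "dist p z \<le> t * (norm v + norm w)"
  proof -
    have "dist p z \<le> norm (s *\<^sub>R v) + norm (\<tau> *\<^sub>R w)"
      unfolding p_def dist_norm by (metis add.assoc add_diff_cancel_left' norm_triangle_ineq)
    also have "\<dots> \<le> t * norm v + t * norm w"
      using s \<tau> by (intro add_mono) (auto intro!: mult_right_mono)
    finally show ?thesis by (simp add: algebra_simps)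
  qed
  ultimately show ?thesis
    by (intro exI[of _ p]) (simp add: D_def power2_eq_square mult.assoc)
qed

text \<open>The same second difference, divided by t^2, equals either mixed derivative at a point
  near z; letting t tend to 0 and using continuity identifies the two.\<close>

lemma dird_commute_real:
  fixes f :: "'a::euclidean_space \<Rightarrow> real"
  assumes f: "class_C 2 f"
  shows "dird [v, w] f z = dird [w, v] f z"
proof -
  define t where "t = (\<lambda>n. inverse (real (Suc n)))"
  have t: "t n > 0" for n by (simp add: t_def)
  obtain p where p: "\<And>n. dist (p n) z \<le> t n * (norm v + norm w)"
    "\<And>n. f (z + t n *\<^sub>R v + t n *\<^sub>R w) - f (z + t n *\<^sub>R v) - f (z + t n *\<^sub>R w) + f z = (t n)\<^sup>2 * dird [v, w] f (p n)"
    using second_difference[OF f t, where z = z and v = v and w = w] by metis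
  obtain q where q: "\<And>n. dist (q n) z \<le> t n * (norm w + norm v)"
    "\<And>n. f (z + t n *\<^sub>R w + t n *\<^sub>R v) - f (z + t n *\<^sub>R w) - f (z + t n *\<^sub>R v) + f z = (t n)\<^sup>2 * dird [w, v] f (q n)"
    using second_difference[OF f t, where z = z and v = w and w = v] by metis
  have eq: "dird [v, w] f (p n) = dird [w, v] f (q n)" for n
  proof -
    have swap: "z + t n *\<^sub>R w + t n *\<^sub>R v = z + t n *\<^sub>R v + t n *\<^sub>R w" by (simp add: ac_simps)
    have "(t n)\<^sup>2 * dird [v, w] f (p n) = (t n)\<^sup>2 * dird [w, v] f (q n)"
      using p(2)[of n] q(2)[of n] unfolding swap by linarith
    then show ?thesis using t[of n] by simp
  qed
  have lim: "x \<longlonglongrightarrow> z" if "\<And>n. dist (x n) z \<le> t n * C" for x C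
  proof -
    have "(\<lambda>n. t n * C) \<longlonglongrightarrow> 0"
      using tendsto_mult_left_zero[OF LIMSEQ_inverse_real_of_nat, of C] unfolding t_def .
    then have "(\<lambda>n. dist (x n) z) \<longlonglongrightarrow> 0"
      by (rule tendsto_sandwich[OF always_eventually always_eventually tendsto_const, rotated 2]) (simp_all add: that)
    then show ?thesis by (subst tendsto_dist_iff)
  qed
  have c: "isCont (dird [a, b] f) z" for a b
  proof -
    have "continuous_on UNIV (dird [a, b] f)"
      by (rule f[unfolded class_C_def, THEN conjunct2, rule_format]) simp
    then show ?thesis by (simp only: continuous_on_eq_continuous_at[OF open_UNIV] UNIV_I ball_UNIV)
  qed
  have "(\<lambda>n. dird [v, w] f (p n)) \<longlonglongrightarrow> dird [v, w] f z"
    by (rule isCont_tendsto_compose[OF c lim[OF p(1)]])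
  moreover have "(\<lambda>n. dird [v, w] f (p n)) \<longlonglongrightarrow> dird [w, v] f z"
    unfolding eq by (rule isCont_tendsto_compose[OF c lim[OF q(1)]])
  ultimately show ?thesis by (rule LIMSEQ_unique)
qed

lemma dird_commute:
  fixes f :: "'a::euclidean_space \<Rightarrow> complex"
  assumes f: "class_C 2 f"
  shows "dird [v, w] f z = dird [w, v] f z"
proof (rule complex_eqI)
  have l: "class_C (length [a, b]) f" for a b :: 'a using f by (simp add: numeral_2_eq_2)
  have Re: "dird [a, b] (\<lambda>z. Re (f z)) z = Re (dird [a, b] f z)" for a b
    by (rule fun_cong[OF dird_bounded_linear_comp[OF bounded_linear_Re l]])
  have Im: "dird [a, b] (\<lambda>z. Im (f z)) z = Im (dird [a, b] f z)" for a b
    by (rule fun_cong[OF dird_bounded_linear_comp[OF bounded_linear_Im l]])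
  show "Re (dird [v, w] f z) = Re (dird [w, v] f z)"
    unfolding Re[symmetric] by (rule dird_commute_real[OF class_C_bounded_linear_comp[OF bounded_linear_Re f]])
  show "Im (dird [v, w] f z) = Im (dird [w, v] f z)"
    unfolding Im[symmetric] by (rule dird_commute_real[OF class_C_bounded_linear_comp[OF bounded_linear_Im f]])
qed

text \<open>A quarter of the Laplacian at 0 of f restricted to the complex line through z in
  direction \<xi>. Written with real derivatives, it applies to real functions directly and is
  visibly linear in f.\<close>

definition levi :: "(complex^'n::finite \<Rightarrow> 'b::real_normed_vector) \<Rightarrow> complex^'n \<Rightarrow> complex^'n \<Rightarrow> 'b" where
  "levi f z \<xi> = (1/4) *\<^sub>R (dird [\<xi>, \<xi>] f z + dird [\<i> *s \<xi>, \<i> *s \<xi>] f z)"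

lemma linear_axis_expansion:
  fixes A :: "complex^'n::finite \<Rightarrow> complex"
  assumes "linear A"
  shows "A \<xi> = (\<Sum>j\<in>UNIV. Re (\<xi> $ j) * A (axis j 1) + Im (\<xi> $ j) * A (axis j \<i>))"
proof -
  have "\<xi> = (\<Sum>j\<in>UNIV. Re (\<xi> $ j) *\<^sub>R axis j 1 + Im (\<xi> $ j) *\<^sub>R axis j \<i>)"
  proof (subst vec_eq_iff, rule allI)
    fix i
    have "(\<Sum>j\<in>UNIV. Re (\<xi> $ j) *\<^sub>R axis j 1 + Im (\<xi> $ j) *\<^sub>R axis j \<i>) $ i =
       (\<Sum>j\<in>UNIV. if j = i then Re (\<xi> $ j) *\<^sub>R 1 + Im (\<xi> $ j) *\<^sub>R \<i> else 0)"
      unfolding sum_component by (intro sum.cong) (auto simp: axis_def)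
    also have "\<dots> = \<xi> $ i" by (simp add: complex_eq_iff)
    finally show "\<xi> $ i = (\<Sum>j\<in>UNIV. Re (\<xi> $ j) *\<^sub>R axis j 1 + Im (\<xi> $ j) *\<^sub>R axis j \<i>) $ i" by simp
  qed
  then have "A \<xi> = A (\<Sum>j\<in>UNIV. Re (\<xi> $ j) *\<^sub>R axis j 1 + Im (\<xi> $ j) *\<^sub>R axis j \<i>)" by simp
  also have "\<dots> = (\<Sum>j\<in>UNIV. Re (\<xi> $ j) * A (axis j 1) + Im (\<xi> $ j) * A (axis j \<i>))"
    by (simp add: linear_sum[OF assms] linear_add[OF assms] linear_scale[OF assms])
      (simp add: scaleR_conv_of_real)
  finally show ?thesis .
qed

text \<open>A real-linear map is the sum of a complex-linear and an antilinear part; the Wirtinger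
  coefficients on the left are the coordinates of these two parts.\<close>

lemma wirtinger_sum:
  fixes A :: "complex^'n::finite \<Rightarrow> complex"
  assumes "linear A"
  shows "(\<Sum>j\<in>UNIV. \<xi> $ j * ((A (axis j 1) - \<i> * A (axis j \<i>)) / 2)) = (A \<xi> - \<i> * A (\<i> *s \<xi>)) / 2"
    and "(\<Sum>j\<in>UNIV. cnj (\<xi> $ j) * ((A (axis j 1) + \<i> * A (axis j \<i>)) / 2)) = (A \<xi> + \<i> * A (\<i> *s \<xi>)) / 2"
  unfolding linear_axis_expansion[OF assms, of \<xi>] linear_axis_expansion[OF assms, of "\<i> *s \<xi>"]
  by (simp_all add: sum_distrib_left sum_divide_distrib flip: sum.distrib sum_subtractf)
    (intro sum.cong refl, simp add: complex_eq_iff field_simps)+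

lemma class_C_dzbar: "class_C (Suc m) f \<Longrightarrow> class_C m (dzbar j f)"
  unfolding dzbar_def [abs_def] divide_inverse
  by (intro class_C_mult[OF class_C_add[OF class_C_SucE(2) class_C_mult[OF class_C_const class_C_SucE(2)]] class_C_const])

lemma class_C_dz: "class_C (Suc m) f \<Longrightarrow> class_C m (dz j f)"
  unfolding dz_def [abs_def] divide_inverse
  by (intro class_C_mult[OF class_C_diff[OF class_C_SucE(2) class_C_mult[OF class_C_const class_C_SucE(2)]] class_C_const])

lemma continuous_on_iddbar: "class_C 2 f \<Longrightarrow> continuous_on S (iddbar f)"
  unfolding iddbar_def numeral_2_eq_2
  by (intro continuous_on_vec_lambda class_C_continuous[of 0] class_C_dz class_C_dzbar)

lemma pair11_iddbar:
  fixes f :: "complex^'n::finite \<Rightarrow> complex"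
  assumes f: "class_C 2 f"
  shows "pair11 (iddbar f z) \<xi> = levi f z \<xi>"
proof -
  note f2 = f[unfolded numeral_2_eq_2]
  let ?D = "\<lambda>v y. frechet_derivative f (at y) v"
  have lin: "linear (frechet_derivative g (at y))" if "class_C (Suc m) g" for g :: "complex^'n \<Rightarrow> complex" and m y
    by (rule has_derivative_linear[OF class_C_SucE(1)[OF that]])
  define E where "E = (\<lambda>l. frechet_derivative (dzbar l f) (at z))"
  have E: "(dzbar l f has_derivative E l) (at z)" for l
    unfolding E_def by (rule class_C_SucE(1)[OF class_C_dzbar[OF f2]])
  \<comment> \<open>The derivative at z of the antilinear part of df evaluated at the fixed vector
    \<xi>. Taking the complex-linear part of \<open>G\<close> at \<xi> then contracts the Hessian
    with \<xi> on both sides.\<close>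
  define G where "G = (\<lambda>v. \<Sum>l\<in>UNIV. cnj (\<xi> $ l) * E l v)"
  have "((\<lambda>y. \<Sum>l\<in>UNIV. cnj (\<xi> $ l) * dzbar l f y) has_derivative G) (at z)"
    unfolding G_def by (intro has_derivative_sum has_derivative_mult_right E)
  moreover have "(\<lambda>y. \<Sum>l\<in>UNIV. cnj (\<xi> $ l) * dzbar l f y) = (\<lambda>y. (?D \<xi> y + \<i> * ?D (\<i> *s \<xi>) y) / 2)"
    unfolding dzbar_def by (intro ext wirtinger_sum(2) lin[OF f2])
  ultimately have 1: "((\<lambda>y. (?D \<xi> y + \<i> * ?D (\<i> *s \<xi>) y) / 2) has_derivative G) (at z)" by simp
  have "((\<lambda>y. (?D \<xi> y + \<i> * ?D (\<i> *s \<xi>) y) / 2) has_derivative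
      (\<lambda>v. (dird [\<xi>, v] f z + \<i> * dird [\<i> *s \<xi>, v] f z) / 2)) (at z)"
    unfolding divide_inverse dird.simps
    by (intro has_derivative_mult_left has_derivative_add has_derivative_mult_right class_C_SucE(1)[OF class_C_SucE(2)[OF f2]])
  with 1 have G: "G = (\<lambda>v. (dird [\<xi>, v] f z + \<i> * dird [\<i> *s \<xi>, v] f z) / 2)"
    by (rule has_derivative_unique)
  have "pair11 (iddbar f z) \<xi> = (\<Sum>j\<in>UNIV. \<Sum>l\<in>UNIV. (E l (axis j 1) - \<i> * E l (axis j \<i>)) / 2 * \<xi> $ j * cnj (\<xi> $ l))"
    by (simp add: pair11_def iddbar_def dz_def E_def)
  also have "\<dots> = (\<Sum>j\<in>UNIV. \<xi> $ j * ((G (axis j 1) - \<i> * G (axis j \<i>)) / 2))"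
    unfolding G_def by (simp only: sum_distrib_left sum_divide_distrib flip: sum_subtractf)
      (intro sum.cong refl, simp add: field_simps)
  also have "\<dots> = (G \<xi> - \<i> * G (\<i> *s \<xi>)) / 2"
    by (rule wirtinger_sum(1)[OF has_derivative_linear[OF 1]])
  \<comment> \<open>The two cross terms, in directions \<xi> and \<open>\<i> *s \<xi>\<close>, carry
    opposite signs and cancel by symmetry of the second derivative.\<close>
  also have "\<dots> = (dird [\<xi>, \<xi>] f z + dird [\<i> *s \<xi>, \<i> *s \<xi>] f z) / 4"
    unfolding G dird_commute[OF f, of \<xi> "\<i> *s \<xi>" z] by (simp add: field_simps del: dird.simps)
  also have "\<dots> = levi f z \<xi>"
    unfolding levi_def by (simp add: scaleR_conv_of_real del: dird.simps)
  finally show ?thesis .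
qed

lemma levi_bounded_linear_comp:
  assumes "bounded_linear F" "class_C 2 f"
  shows "levi (\<lambda>z. F (f z)) z \<xi> = F (levi f z \<xi>)"
proof -
  have "dird [a, b] (\<lambda>z. F (f z)) z = F (dird [a, b] f z)" for a b
    using dird_bounded_linear_comp[OF assms(1), of "[a, b]" f] assms(2) by (simp only: list.size numeral_2_eq_2 add_0_right add_Suc_right)
  then show ?thesis
    unfolding levi_def using assms(1)[THEN bounded_linear.linear] by (simp only: linear_scale linear_add)
qed

lemma levi_add:
  assumes "class_C 2 f" "class_C 2 g"
  shows "levi (\<lambda>z. f z + g z) z \<xi> = levi f z \<xi> + levi g z \<xi>"
proof -
  have "dird [a, b] (\<lambda>z. f z + g z) z = dird [a, b] f z + dird [a, b] g z" for a b
    using dird_add[of "[a, b]" f g] assms by (simp only: list.size numeral_2_eq_2 add_0_right add_Suc_right)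
  then show ?thesis unfolding levi_def by (simp only: scaleR_add_right add_ac)
qed

lemma pair11_iddbar_real:
  assumes "class_C 2 u"
  shows "pair11 (iddbar_real u z) \<xi> = complex_of_real (levi u z \<xi>)"
  by (simp only: pair11_iddbar[OF class_C_bounded_linear_comp[OF bounded_linear_of_real assms]]
      levi_bounded_linear_comp[OF bounded_linear_of_real assms])

lemma pair11_scaleR: "pair11 A (t *\<^sub>R \<xi>) = (complex_of_real t)\<^sup>2 * pair11 A \<xi>"
  unfolding pair11_def sum_distrib_left
  by (intro sum.cong refl)
    (simp only: vector_scaleR_component, simp add: scaleR_conv_of_real power2_eq_square)

lemma pair11_add: "pair11 (A + B) \<xi> = pair11 A \<xi> + pair11 B \<xi>"
  unfolding pair11_def by (simp add: distrib_right sum.distrib)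

text \<open>A crude bound that estimates each of the k^2 summands separately; only finiteness of the
  constant matters.\<close>

lemma norm_pair11_le:
  "norm (pair11 A \<xi>) \<le> (real CARD('n))\<^sup>2 * norm A * (norm \<xi>)\<^sup>2" for A :: "complex^'n^'n::finite"
proof -
  have "norm (A $ j $ l * \<xi> $ j * cnj (\<xi> $ l)) \<le> norm A * norm \<xi> * norm \<xi>" for j l
    unfolding norm_mult complex_mod_cnj
    by (intro mult_mono order_trans[OF Finite_Cartesian_Product.norm_nth_le Finite_Cartesian_Product.norm_nth_le] Finite_Cartesian_Product.norm_nth_le) auto
  then have "norm (pair11 A \<xi>) \<le> (\<Sum>j\<in>(UNIV::'n set). \<Sum>l\<in>(UNIV::'n set). norm A * norm \<xi> * norm \<xi>)"
    unfolding pair11_def by (intro sum_norm_le)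
  then show ?thesis by (simp add: power2_eq_square mult_ac)
qed

section \<open>Extension of positive functionals\<close>

definition bounded_fun_on :: "'a set \<Rightarrow> ('a \<Rightarrow> real) \<Rightarrow> bool" where
  "bounded_fun_on S g \<longleftrightarrow> (\<exists>M. \<forall>p\<in>S. \<bar>g p\<bar> \<le> M)"

lemma bounded_fun_const: "bounded_fun_on S (\<lambda>p. t)"
  unfolding bounded_fun_on_def by auto

lemma bounded_fun_scale: "bounded_fun_on S g \<Longrightarrow> bounded_fun_on S (\<lambda>p. t * g p)"
proof -
  assume "bounded_fun_on S g"
  then obtain M where "\<forall>p\<in>S. \<bar>g p\<bar> \<le> M" unfolding bounded_fun_on_def by auto
  then have "\<forall>p\<in>S. \<bar>t * g p\<bar> \<le> \<bar>t\<bar> * M" by (simp add: abs_mult mult_left_mono)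
  then show ?thesis unfolding bounded_fun_on_def by blast
qed

text \<open>A partial positive functional is encoded by its graph; single-valuedness follows from positivity.\<close>

definition positive_graph :: "'a set \<Rightarrow> (('a \<Rightarrow> real) \<times> real) set \<Rightarrow> bool" where
  "positive_graph S G \<longleftrightarrow>
     (\<forall>g a h b. (g, a) \<in> G \<longrightarrow> (h, b) \<in> G \<longrightarrow> ((\<lambda>p. g p + h p), a + b) \<in> G) \<and>
     (\<forall>t g a. (g, a) \<in> G \<longrightarrow> ((\<lambda>p. t * g p), t * a) \<in> G) \<and>
     (\<forall>g a. (g, a) \<in> G \<longrightarrow> (\<forall>p\<in>S. 0 \<le> g p) \<longrightarrow> 0 \<le> a)"

lemma positive_graphD:
  assumes "positive_graph S G"
  shows "(g, a) \<in> G \<Longrightarrow> (h, b) \<in> G \<Longrightarrow> ((\<lambda>p. g p + h p), a + b) \<in> G"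
    and "(g, a) \<in> G \<Longrightarrow> ((\<lambda>p. t * g p), t * a) \<in> G"
    and "(g, a) \<in> G \<Longrightarrow> (\<And>p. p \<in> S \<Longrightarrow> 0 \<le> g p) \<Longrightarrow> 0 \<le> a"
  using assms unfolding positive_graph_def by simp_all

text \<open>Positivity applied to h - g. Taking g = h in both orders shows that the graph is
  single-valued.\<close>

lemma positive_graph_mono:
  assumes G: "positive_graph S G" and "(g, a) \<in> G" "(h, b) \<in> G" "\<And>p. p \<in> S \<Longrightarrow> g p \<le> h p"
  shows "a \<le> b"
proof -
  have "((\<lambda>p. h p + (-1) * g p), b + (-1) * a) \<in> G"
    by (intro positive_graphD(1)[OF G] positive_graphD(2)[OF G] assms)
  from positive_graphD(3)[OF G this] show ?thesis using assms(4) by simp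
qed

text \<open>The one-dimensional step of the M. Riesz extension: the new value is the supremum of the
  values of minorants of \<open>g0\<close>. Since \<open>g0\<close> is bounded, multiples of
  \<open>e\<close> give a minorant and a majorant, so this supremum is finite.\<close>

lemma positive_graph_extend:
  assumes G: "positive_graph S G" and e: "(e, k) \<in> G" "\<And>p. p \<in> S \<Longrightarrow> e p = 1"
    and g0: "bounded_fun_on S g0"
  shows "\<exists>a0 G'. positive_graph S G' \<and> G \<subseteq> G' \<and> (g0, a0) \<in> G'"
proof -
  obtain M where M: "\<And>p. p \<in> S \<Longrightarrow> \<bar>g0 p\<bar> \<le> M" using g0 unfolding bounded_fun_on_def by blast
  have const: "((\<lambda>p. t * e p), t * k) \<in> G" for t by (rule positive_graphD(2)[OF G e(1)])
  define A where "A = {a. \<exists>g. (g, a) \<in> G \<and> (\<forall>p\<in>S. g p \<le> g0 p)}"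
  have "(- M) * k \<in> A"
    unfolding A_def using const[of "- M"] M e(2) by fastforce
  then have A_ne: "A \<noteq> {}" by blast
  have upper: "a \<le> b" if a: "a \<in> A" and h: "(h, b) \<in> G" "\<And>p. p \<in> S \<Longrightarrow> g0 p \<le> h p" for a h b
  proof -
    obtain g where g: "(g, a) \<in> G" "\<forall>p\<in>S. g p \<le> g0 p" using a unfolding A_def by auto
    show ?thesis
      using g(2) h(2) by (intro positive_graph_mono[OF G g(1) h(1)]) (meson order_trans)
  qed
  have "a \<le> M * k" if "a \<in> A" for a
    by (rule upper[OF that const[of M]]) (use M e(2) in fastforce)
  then have bdd: "bdd_above A" by (rule bdd_aboveI)
  define a0 where "a0 = Sup A"
  have lower: "a \<le> a0" if "(g, a) \<in> G" "\<And>p. p \<in> S \<Longrightarrow> g p \<le> g0 p" for g a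
    unfolding a0_def by (rule cSup_upper[OF _ bdd]) (use that in \<open>auto simp: A_def\<close>)
  have upper0: "a0 \<le> b" if "(h, b) \<in> G" "\<And>p. p \<in> S \<Longrightarrow> g0 p \<le> h p" for h b
    unfolding a0_def by (rule cSup_least[OF A_ne]) (rule upper[OF _ that])
  define G' where "G' = {((\<lambda>p. g p + t * g0 p), a + t * a0) | g a t. (g, a) \<in> G}"
  have G'I: "(h, b) \<in> G'" if "(g, a) \<in> G" "h = (\<lambda>p. g p + t * g0 p)" "b = a + t * a0" for h b g a t
    using that unfolding G'_def by blast
  have "positive_graph S G'"
    unfolding positive_graph_def
  proof (intro conjI allI impI)
    fix g a h b assume "(g, a) \<in> G'" "(h, b) \<in> G'"
    then obtain g1 a1 t1 g2 a2 t2 where "(g1, a1) \<in> G" "(g2, a2) \<in> G"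
      "g = (\<lambda>p. g1 p + t1 * g0 p)" "a = a1 + t1 * a0" "h = (\<lambda>p. g2 p + t2 * g0 p)" "b = a2 + t2 * a0"
      unfolding G'_def by blast
    then show "((\<lambda>p. g p + h p), a + b) \<in> G'"
      by (intro G'I[OF positive_graphD(1)[OF G], of g1 a1 g2 a2 _ "t1 + t2"]) (auto simp: algebra_simps)
  next
    fix t g a assume "(g, a) \<in> G'"
    then obtain g1 a1 t1 where "(g1, a1) \<in> G" "g = (\<lambda>p. g1 p + t1 * g0 p)" "a = a1 + t1 * a0"
      unfolding G'_def by blast
    then show "((\<lambda>p. t * g p), t * a) \<in> G'"
      by (intro G'I[OF positive_graphD(2)[OF G], of g1 a1 _ t "t * t1"]) (auto simp: algebra_simps)
  next
    fix g a assume "(g, a) \<in> G'" and pos: "\<forall>p\<in>S. 0 \<le> g p"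
    then obtain g1 a1 t where g1: "(g1, a1) \<in> G" "g = (\<lambda>p. g1 p + t * g0 p)" "a = a1 + t * a0"
      unfolding G'_def by blast
    \<comment> \<open>On S, g1 + t g0 \<ge> 0 says that -g1/t is a minorant of g0 if t > 0 and a
      majorant if t < 0; the choice of \<open>a0\<close> bounds its value accordingly.\<close>
    have scaled: "((\<lambda>p. (- inverse t) * g1 p), (- inverse t) * a1) \<in> G"
      by (rule positive_graphD(2)[OF G g1(1)])
    show "0 \<le> a"
    proof (cases t "0::real" rule: linorder_cases)
      case equal
      then show ?thesis using positive_graphD(3)[OF G g1(1)] pos g1 by simp
    next
      case greater
      have "(- inverse t) * a1 \<le> a0"
        by (rule lower[OF scaled]) (use pos greater in \<open>auto simp: g1(2) field_simps\<close>)
      then show ?thesis using greater by (simp add: g1(3) field_simps)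
    next
      case less
      have "a0 \<le> (- inverse t) * a1"
        by (rule upper0[OF scaled]) (use pos less in \<open>auto simp: g1(2) field_simps\<close>)
      then show ?thesis using less by (simp add: g1(3) field_simps)
    qed
  qed
  moreover have "G \<subseteq> G'"
    by (auto intro!: G'I[where t = 0])
  moreover have "(g0, a0) \<in> G'"
    by (rule G'I[OF const[of 0], of _ 1]) auto
  ultimately show ?thesis by blast
qed

locale positive_functional =
  fixes S :: "'a set" and \<Lambda> :: "('a \<Rightarrow> real) \<Rightarrow> real"
  assumes add: "bounded_fun_on S g \<Longrightarrow> bounded_fun_on S h \<Longrightarrow> \<Lambda> (\<lambda>p. g p + h p) = \<Lambda> g + \<Lambda> h"
    and scale: "bounded_fun_on S g \<Longrightarrow> \<Lambda> (\<lambda>p. t * g p) = t * \<Lambda> g"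
    and nonneg: "bounded_fun_on S g \<Longrightarrow> (\<And>p. p \<in> S \<Longrightarrow> 0 \<le> g p) \<Longrightarrow> 0 \<le> \<Lambda> g"

text \<open>M. Riesz extension; the constant 1 on \<open>S\<close> is the order unit.\<close>

lemma positive_functional_extension:
  assumes G0: "positive_graph S G0" and e: "(e, k) \<in> G0" "\<And>p. p \<in> S \<Longrightarrow> e p = 1"
  shows "\<exists>\<Lambda>. positive_functional S \<Lambda> \<and> (\<forall>g a. (g, a) \<in> G0 \<longrightarrow> \<Lambda> g = a)"
proof -
  define \<A> where "\<A> = {G. positive_graph S G \<and> G0 \<subseteq> G}"
  have "\<exists>M\<in>\<A>. \<forall>X\<in>\<A>. M \<subseteq> X \<longrightarrow> X = M"
  proof (rule subset_Zorn_nonempty)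
    show "\<A> \<noteq> {}" using G0 unfolding \<A>_def by blast
    fix C assume C: "C \<noteq> {}" "subset.chain \<A> C"
    have sub: "C \<subseteq> \<A>" using C(2) by (auto simp: subset_chain_def)
    have pg: "positive_graph S G" if "G \<in> C" for G using sub that unfolding \<A>_def by blast
    have "positive_graph S (\<Union>C)"
      unfolding positive_graph_def
    proof (intro conjI allI impI)
      fix g a h b assume "(g, a) \<in> \<Union>C" "(h, b) \<in> \<Union>C"
      then obtain G1 G2 where G: "G1 \<in> C" "G2 \<in> C" "(g, a) \<in> G1" "(h, b) \<in> G2" by (elim UnionE)
      then have "G1 \<subseteq> G2 \<or> G2 \<subseteq> G1" using C(2) by (auto simp: subset_chain_def)
      then obtain G where "G \<in> C" "(g, a) \<in> G" "(h, b) \<in> G" using G by (meson subsetD)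
      then show "((\<lambda>p. g p + h p), a + b) \<in> \<Union>C" by (intro UnionI positive_graphD(1)[OF pg])
    next
      fix t g a assume "(g, a) \<in> \<Union>C"
      then obtain G where "G \<in> C" "(g, a) \<in> G" by (elim UnionE)
      then show "((\<lambda>p. t * g p), t * a) \<in> \<Union>C" by (intro UnionI positive_graphD(2)[OF pg])
    next
      fix g a assume ga: "(g, a) \<in> \<Union>C" and pos: "\<forall>p\<in>S. 0 \<le> g p"
      from ga obtain G where G: "G \<in> C" "(g, a) \<in> G" by (elim UnionE)
      show "0 \<le> a" by (rule positive_graphD(3)[OF pg[OF G(1)] G(2)]) (use pos in simp)
    qed
    then show "\<Union>C \<in> \<A>" using C(1) sub unfolding \<A>_def by blast
  qed
  then obtain G where "G \<in> \<A>" and max': "\<forall>X\<in>\<A>. G \<subseteq> X \<longrightarrow> X = G" by (elim bexE)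
  then have G: "positive_graph S G" "G0 \<subseteq> G" unfolding \<A>_def by simp_all
  have max: "X = G" if "positive_graph S X" "G0 \<subseteq> X" "G \<subseteq> X" for X
    using max' that unfolding \<A>_def by simp
  have ek: "(e, k) \<in> G" by (rule subsetD[OF G(2) e(1)])
  \<comment> \<open>A bounded function outside the domain would permit a proper one-step extension,
    against maximality.\<close>
  have total: "\<exists>a. (g, a) \<in> G" if g: "bounded_fun_on S g" for g
  proof -
    obtain a0 G' where G': "positive_graph S G'" "G \<subseteq> G'" "(g, a0) \<in> G'"
      using positive_graph_extend[OF G(1) ek _ g] e(2) by auto
    have "G' = G" by (rule max[OF G'(1) order_trans[OF G(2) G'(2)] G'(2)])
    with G'(3) have "(g, a0) \<in> G" by simp
    then show ?thesis by (rule exI)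
  qed
  define \<Lambda> where "\<Lambda> = (\<lambda>g. THE a. (g, a) \<in> G)"
  have \<Lambda>: "\<Lambda> g = a" if "(g, a) \<in> G" for g a
    unfolding \<Lambda>_def
  proof (rule the_equality)
    show "(g, a) \<in> G" by (rule that)
    fix b assume "(g, b) \<in> G"
    then show "b = a"
      using positive_graph_mono[OF G(1) that, of g b] positive_graph_mono[OF G(1) _ that, of g b] by simp
  qed
  have "positive_functional S \<Lambda>"
  proof
    fix g h assume "bounded_fun_on S g" "bounded_fun_on S h"
    then obtain a b where ab: "(g, a) \<in> G" "(h, b) \<in> G" by (auto dest!: total)
    show "\<Lambda> (\<lambda>p. g p + h p) = \<Lambda> g + \<Lambda> h"
      using \<Lambda>[OF positive_graphD(1)[OF G(1) ab]] \<Lambda>[OF ab(1)] \<Lambda>[OF ab(2)] by simp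
  next
    fix t g assume "bounded_fun_on S g"
    then obtain a where a: "(g, a) \<in> G" by (auto dest!: total)
    show "\<Lambda> (\<lambda>p. t * g p) = t * \<Lambda> g"
      using \<Lambda>[OF positive_graphD(2)[OF G(1) a]] \<Lambda>[OF a] by simp
  next
    fix g assume "bounded_fun_on S g" and pos: "\<And>p. p \<in> S \<Longrightarrow> 0 \<le> g p"
    then obtain a where a: "(g, a) \<in> G" by (auto dest!: total)
    show "0 \<le> \<Lambda> g" using positive_graphD(3)[OF G(1) a pos] \<Lambda>[OF a] by simp
  qed
  moreover have "\<Lambda> g = a" if "(g, a) \<in> G0" for g a
    by (rule \<Lambda>[OF subsetD[OF G(2) that]])
  ultimately show ?thesis by (intro exI[of _ \<Lambda>]) simp
qed

section \<open>Monotonicity and the supremum bound for positive functionals\<close>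

context positive_functional
begin

lemma mono:
  assumes "bounded_fun_on S g" "bounded_fun_on S h" "\<And>p. p \<in> S \<Longrightarrow> g p \<le> h p"
  shows "\<Lambda> g \<le> \<Lambda> h"
proof -
  obtain M N where MN: "\<forall>p\<in>S. \<bar>g p\<bar> \<le> M" "\<forall>p\<in>S. \<bar>h p\<bar> \<le> N"
    using assms unfolding bounded_fun_on_def by auto
  have b: "bounded_fun_on S (\<lambda>p. (-1) * g p)"
    unfolding bounded_fun_on_def by (intro exI[of _ M]) (use MN in auto)
  have "bounded_fun_on S (\<lambda>p. h p + (-1) * g p)"
    unfolding bounded_fun_on_def by (intro exI[of _ "N + M"]) (use MN in fastforce)
  then have "0 \<le> \<Lambda> (\<lambda>p. h p + (-1) * g p)"
    by (rule nonneg) (use assms(3) in auto)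
  then show ?thesis using add[OF assms(2) b] scale[OF assms(1), of "-1"] by simp
qed

lemma cong:
  assumes "bounded_fun_on S g" "bounded_fun_on S h" "\<And>p. p \<in> S \<Longrightarrow> g p = h p"
  shows "\<Lambda> g = \<Lambda> h"
  by (rule antisym; rule mono) (use assms in auto)

lemma zero: "\<Lambda> (\<lambda>p. 0) = 0"
  using scale[OF bounded_fun_const, of 0 0] by simp

text \<open>g lies between the constants -M and M on S. All continuity and support properties of the
  current rest on this estimate.\<close>

lemma abs_le:
  assumes "\<And>p. p \<in> S \<Longrightarrow> \<bar>g p\<bar> \<le> M"
  shows "\<bar>\<Lambda> g\<bar> \<le> M * \<Lambda> (\<lambda>p. 1)"
proof -
  have g: "bounded_fun_on S g" unfolding bounded_fun_on_def using assms by blast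
  have k: "\<Lambda> (\<lambda>p. t) = t * \<Lambda> (\<lambda>p. 1)" for t using scale[OF bounded_fun_const, of t 1] by simp
  have "\<Lambda> g \<le> \<Lambda> (\<lambda>p. M)" by (rule mono[OF g bounded_fun_const]) (use assms in fastforce)
  moreover have "\<Lambda> (\<lambda>p. - M) \<le> \<Lambda> g" by (rule mono[OF bounded_fun_const g]) (use assms in fastforce)
  ultimately show ?thesis using k[of M] k[of "- M"] by (simp add: abs_le_iff)
qed

end

section \<open>Currents given by positive functionals\<close>

lemma pair11_scale_form: "pair11 (scale_form f \<omega> z) \<xi> = f z * pair11 (\<omega> z) \<xi>"
  by (simp add: pair11_def scale_form_def sum_distrib_left mult.assoc)

lemma continuous_on_scale_form:
  "continuous_on S f \<Longrightarrow> continuous_on S \<omega> \<Longrightarrow> continuous_on S (scale_form f \<omega>)"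
  unfolding scale_form_def
  by (intro continuous_on_vec_lambda continuous_on_mult continuous_on_component)

lemma compact_supp_scale_form: "compact (supp f) \<Longrightarrow> compact (supp (scale_form f \<omega>))"
proof -
  assume c: "compact (supp f)"
  have "z \<in> supp f" if "scale_form f \<omega> z \<noteq> 0" for z
    by (rule in_supp) (use that in \<open>auto simp: scale_form_def vec_eq_iff\<close>)
  then show ?thesis by (rule compact_supp[OF c])
qed

lemma test_continuous: "test f \<Longrightarrow> continuous_on S f"
  using class_C_continuous unfolding test_def by blast

lemma test_of_real:
  assumes "test \<beta>" shows "test (\<lambda>z. complex_of_real (\<beta> z))"
proof -
  have "supp (\<lambda>z. complex_of_real (\<beta> z)) = supp \<beta>" by (simp add: supp_def)
  moreover have "class_C m (\<lambda>z. complex_of_real (\<beta> z))" for m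
    by (rule class_C_bounded_linear_comp[OF bounded_linear_of_real]) (use assms in \<open>simp add: test_def\<close>)
  ultimately show ?thesis using assms by (simp add: test_def)
qed

text \<open>
  A positive functional \<open>\<Lambda>\<close> on functions on a set \<open>S\<close> of unit tangent vectors acts on a (1,1)-form
  through its values on these vectors.  A Riesz representing measure of \<open>\<Lambda>\<close> is never needed.
\<close>

locale averaged_current = positive_functional S \<Lambda>
  for S :: "((complex^'n::finite) \<times> (complex^'n)) set"
    and \<Lambda> :: "((complex^'n) \<times> (complex^'n) \<Rightarrow> real) \<Rightarrow> real" +
  fixes c :: "complex^'n" and r :: real
  assumes S_cball: "p \<in> S \<Longrightarrow> fst p \<in> cball c r"
    and S_unit: "p \<in> S \<Longrightarrow> norm (snd p) = 1"
begin

text \<open>\<Lambda> is real, so real and imaginary parts are averaged separately. The formula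
  makes no use of smoothness or compact support, which allows it to be evaluated on
  \<open>iddbar_real \<phi>\<close> directly.\<close>

definition cur :: "'n form11 \<Rightarrow> complex" where
  "cur \<omega> = Complex (\<Lambda> (\<lambda>p. Re (pair11 (\<omega> (fst p)) (snd p)))) (\<Lambda> (\<lambda>p. Im (pair11 (\<omega> (fst p)) (snd p))))"

lemma norm_pair_le:
  assumes "p \<in> S" "\<And>z. z \<in> cball c r \<Longrightarrow> norm (\<omega> z) \<le> M"
  shows "norm (pair11 (\<omega> (fst p)) (snd p)) \<le> (real CARD('n))\<^sup>2 * M"
proof -
  have "norm (pair11 (\<omega> (fst p)) (snd p)) \<le> (real CARD('n))\<^sup>2 * norm (\<omega> (fst p))"
    using norm_pair11_le[of "\<omega> (fst p)" "snd p"] S_unit[OF assms(1)] by simp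
  also have "\<dots> \<le> (real CARD('n))\<^sup>2 * M"
    by (rule mult_left_mono[OF assms(2)[OF S_cball[OF assms(1)]]]) simp
  finally show ?thesis .
qed

lemma bounded_pair:
  assumes "continuous_on UNIV \<omega>"
  shows "bounded_fun_on S (\<lambda>p. Re (pair11 (\<omega> (fst p)) (snd p)))"
    and "bounded_fun_on S (\<lambda>p. Im (pair11 (\<omega> (fst p)) (snd p)))"
proof -
  have "compact (\<omega> ` cball c r)"
    by (rule compact_continuous_image[OF continuous_on_subset[OF assms] compact_cball]) simp
  then have "bounded (\<omega> ` cball c r)" by (rule compact_imp_bounded)
  then obtain M where "\<And>z. z \<in> cball c r \<Longrightarrow> norm (\<omega> z) \<le> M" unfolding bounded_iff by blast
  from norm_pair_le[OF _ this]
  have M: "norm (pair11 (\<omega> (fst p)) (snd p)) \<le> (real CARD('n))\<^sup>2 * M" if "p \<in> S" for p using that by simp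
  show "bounded_fun_on S (\<lambda>p. Re (pair11 (\<omega> (fst p)) (snd p)))"
    unfolding bounded_fun_on_def using order_trans[OF abs_Re_le_cmod M] by blast
  show "bounded_fun_on S (\<lambda>p. Im (pair11 (\<omega> (fst p)) (snd p)))"
    unfolding bounded_fun_on_def using order_trans[OF abs_Im_le_cmod M] by blast
qed

lemma cur_add:
  assumes "continuous_on UNIV \<omega>" "continuous_on UNIV \<eta>"
  shows "cur (\<lambda>z. \<omega> z + \<eta> z) = cur \<omega> + cur \<eta>"
  unfolding cur_def pair11_add plus_complex.simps
  by (simp add: add bounded_pair assms complex_eq_iff)

lemma cur_scale:
  assumes "continuous_on UNIV \<omega>"
  shows "cur (scale_form (\<lambda>_. t) \<omega>) = t * cur \<omega>"
proof -
  let ?R = "\<lambda>p. Re (pair11 (\<omega> (fst p)) (snd p))" and ?I = "\<lambda>p. Im (pair11 (\<omega> (fst p)) (snd p))"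
  note b = bounded_pair[OF assms]
  have "\<Lambda> (\<lambda>p. Re t * ?R p + (- Im t) * ?I p) = Re t * \<Lambda> ?R + (- Im t) * \<Lambda> ?I"
    by (subst add[OF bounded_fun_scale bounded_fun_scale, OF b]) (simp only: scale[OF b(1)] scale[OF b(2)])
  moreover have "\<Lambda> (\<lambda>p. Re t * ?I p + Im t * ?R p) = Re t * \<Lambda> ?I + Im t * \<Lambda> ?R"
    by (subst add[OF bounded_fun_scale bounded_fun_scale, OF b(2) b(1)]) (simp only: scale[OF b(1)] scale[OF b(2)])
  ultimately show ?thesis
    unfolding cur_def pair11_scale_form by (simp add: complex_eq_iff)
qed

lemma cur_diff:
  assumes "continuous_on UNIV \<omega>" "continuous_on UNIV \<eta>"
  shows "cur (\<lambda>z. \<omega> z - \<eta> z) = cur \<omega> - cur \<eta>"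
proof -
  have m: "scale_form (\<lambda>_. - 1) \<eta> = (\<lambda>z. - \<eta> z)" by (auto simp: scale_form_def vec_eq_iff)
  have "cur (\<lambda>z. - \<eta> z) = - cur \<eta>"
    using cur_scale[OF assms(2), of "- 1"] unfolding m by simp
  then show ?thesis
    using cur_add[OF assms(1) continuous_on_minus[OF assms(2)]] by simp
qed

text \<open>Only values of \<omega> over the closed ball enter, so this yields order 0 and at the
  same time the location of the support. The factor 2 combines real and imaginary part.\<close>

lemma cur_norm_le:
  assumes "\<And>z. z \<in> cball c r \<Longrightarrow> norm (\<omega> z) \<le> M"
  shows "norm (cur \<omega>) \<le> 2 * ((real CARD('n))\<^sup>2 * M * \<Lambda> (\<lambda>p. 1))"
proof -
  note le = norm_pair_le[OF _ assms]
  have "\<bar>Re (cur \<omega>)\<bar> \<le> (real CARD('n))\<^sup>2 * M * \<Lambda> (\<lambda>p. 1)"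
    unfolding cur_def complex.sel by (rule abs_le) (rule order_trans[OF abs_Re_le_cmod le])
  moreover have "\<bar>Im (cur \<omega>)\<bar> \<le> (real CARD('n))\<^sup>2 * M * \<Lambda> (\<lambda>p. 1)"
    unfolding cur_def complex.sel by (rule abs_le) (rule order_trans[OF abs_Im_le_cmod le])
  ultimately show ?thesis using cmod_le[of "cur \<omega>"] by linarith
qed

lemma cur_eq_zero:
  assumes "\<And>z. z \<in> cball c r \<Longrightarrow> \<omega> z = 0"
  shows "cur \<omega> = 0"
  using cur_norm_le[of \<omega> 0] assms by simp

lemma cur_nonneg:
  assumes "continuous_on UNIV \<omega>" and pos: "\<And>p. p \<in> S \<Longrightarrow> pair11 (\<omega> (fst p)) (snd p) \<in> \<real>\<^sub>\<ge>\<^sub>0"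
  shows "cur \<omega> \<in> \<real>\<^sub>\<ge>\<^sub>0"
proof -
  have "0 \<le> \<Lambda> (\<lambda>p. Re (pair11 (\<omega> (fst p)) (snd p)))"
    by (rule nonneg[OF bounded_pair(1)[OF assms(1)]]) (use pos in \<open>simp add: complex_nonneg_Reals_iff\<close>)
  moreover have "\<Lambda> (\<lambda>p. Im (pair11 (\<omega> (fst p)) (snd p))) = \<Lambda> (\<lambda>p. 0)"
    by (rule cong[OF bounded_pair(2)[OF assms(1)] bounded_fun_const]) (use pos in \<open>simp add: complex_nonneg_Reals_iff\<close>)
  ultimately show ?thesis by (simp add: cur_def complex_nonneg_Reals_iff zero)
qed

lemma cur_tendsto:
  assumes \<Phi>: "\<And>n. continuous_on UNIV (\<Phi> n)" and \<omega>: "continuous_on UNIV \<omega>"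
    and lim: "uniform_limit UNIV \<Phi> \<omega> sequentially"
  shows "(\<lambda>n. cur (\<Phi> n)) \<longlonglongrightarrow> cur \<omega>"
proof (rule tendstoI)
  fix e :: real assume e: "e > 0"
  \<comment> \<open>The added 1 keeps \<open>C\<close> positive even if \<Lambda>(1) = 0 and makes
    the final estimate strict, as (C - 1) e / C < e.\<close>
  define C where "C = 2 * (real CARD('n))\<^sup>2 * \<Lambda> (\<lambda>p. 1) + 1"
  have C: "C > 0"
    unfolding C_def using nonneg[OF bounded_fun_const, of 1] by (simp add: add_nonneg_pos)
  have "\<forall>\<^sub>F n in sequentially. \<forall>z\<in>UNIV. dist (\<Phi> n z) (\<omega> z) < e / C"
    using uniform_limitD[OF lim] e C by simp
  then show "\<forall>\<^sub>F n in sequentially. dist (cur (\<Phi> n)) (cur \<omega>) < e"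
  proof eventually_elim
    case (elim n)
    have "norm (cur (\<lambda>z. \<Phi> n z - \<omega> z)) \<le> 2 * ((real CARD('n))\<^sup>2 * (e / C) * \<Lambda> (\<lambda>p. 1))"
      by (rule cur_norm_le) (use elim in \<open>simp add: dist_norm less_imp_le\<close>)
    also have "\<dots> = (C - 1) * (e / C)" by (simp add: C_def)
    also have "\<dots> < e" using e C by (simp add: field_simps)
    finally show ?case by (simp add: dist_norm cur_diff[OF \<Phi> \<omega>])
  qed
qed

lemma positive_current11_cur: "positive_current11 cur"
  unfolding positive_current11_def current11_def
proof (intro conjI allI impI)
  fix \<omega> \<eta> :: "'n form11" assume "test \<omega>" "test \<eta>"
  then show "cur (\<lambda>z. \<omega> z + \<eta> z) = cur \<omega> + cur \<eta>" by (intro cur_add test_continuous)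
next
  fix t and \<omega> :: "'n form11" assume "test \<omega>"
  then show "cur (scale_form (\<lambda>_. t) \<omega>) = t * cur \<omega>" by (intro cur_scale test_continuous)
next
  fix \<Phi> :: "nat \<Rightarrow> 'n form11" assume \<Phi>: "test_null_seq \<Phi>"
  have lim: "uniform_limit UNIV \<Phi> (\<lambda>_. 0) sequentially"
    using \<Phi>[unfolded test_null_seq_def, THEN conjunct2, THEN conjunct2, rule_format, of "[]"] by simp
  have "(\<lambda>n. cur (\<Phi> n)) \<longlonglongrightarrow> cur (\<lambda>_. 0)"
    using \<Phi> by (intro cur_tendsto lim test_continuous continuous_on_const) (simp add: test_null_seq_def)
  then show "(\<lambda>n. cur (\<Phi> n)) \<longlonglongrightarrow> 0" by (simp add: cur_eq_zero)
next
  fix \<omega> :: "'n form11" assume "test \<omega>" "positive_form \<omega>"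
  then show "cur \<omega> \<in> \<real>\<^sub>\<ge>\<^sub>0"
    by (intro cur_nonneg test_continuous) (auto simp: positive_form_def)
qed

section \<open>Continuous forms, support and pairing of the averaged current\<close>

lemma current_ext_cur:
  assumes \<omega>: "continuous_on UNIV \<omega>" and cs: "compact (supp \<omega>)"
  shows "current_ext cur \<omega> = cur \<omega>"
proof -
  obtain R where R: "\<And>z. z \<in> supp \<omega> \<Longrightarrow> norm z \<le> R" "R > 0"
    using compact_imp_bounded[OF cs] unfolding bounded_pos by auto
  obtain \<beta> :: "complex^'n \<Rightarrow> real" where \<beta>: "test \<beta>" "\<forall>z\<in>cball 0 R. \<beta> z = 1"
    using bump_exists[of R "R + 1" "0 :: complex^'n"] R(2) by auto
  \<comment> \<open>As \<beta> is 1 on the support of \<omega>, smooth approximation of the product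
    approximates \<omega> itself.\<close>
  have "(\<lambda>z. \<beta> z *\<^sub>R \<omega> z) = \<omega>"
  proof
    fix z show "\<beta> z *\<^sub>R \<omega> z = \<omega> z"
      using \<beta>(2) R(1)[of z] in_supp[of \<omega> z] by (cases "\<omega> z = 0") auto
  qed
  then obtain \<Phi> where \<Phi>: "\<And>n. test (\<Phi> n)" "\<And>n. supp (\<Phi> n) \<subseteq> supp \<beta>" "uniform_limit UNIV \<Phi> \<omega> sequentially"
    using smooth_approximation[OF \<beta>(1) \<omega>] by auto
  have cb: "compact (supp \<beta>)" using \<beta>(1) unfolding test_def by simp
  show ?thesis
    unfolding current_ext_def
  proof (rule the_equality, intro allI impI)
    fix \<Psi> :: "nat \<Rightarrow> 'n form11" assume "\<forall>n. test (\<Psi> n)" "uniform_limit UNIV \<Psi> \<omega> sequentially"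
    then show "(\<lambda>n. cur (\<Psi> n)) \<longlonglongrightarrow> cur \<omega>"
      by (intro cur_tendsto \<omega> test_continuous) auto
  next
    \<comment> \<open>Uniqueness in the definite description needs at least one admissible sequence;
      without one every number would qualify. The sequence built above serves.\<close>
    fix a assume "\<forall>\<Phi>. (\<forall>n. test (\<Phi> n)) \<longrightarrow> (\<exists>L. compact L \<and> (\<forall>n. supp (\<Phi> n) \<subseteq> L)) \<longrightarrow>
        uniform_limit UNIV \<Phi> \<omega> sequentially \<longrightarrow> (\<lambda>n. cur (\<Phi> n)) \<longlonglongrightarrow> a"
    moreover have "\<exists>L. compact L \<and> (\<forall>n. supp (\<Phi> n) \<subseteq> L)" using \<Phi>(2) cb by auto
    ultimately have "(\<lambda>n. cur (\<Phi> n)) \<longlonglongrightarrow> a" using \<Phi>(1,3) by simp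
    moreover have "(\<lambda>n. cur (\<Phi> n)) \<longlonglongrightarrow> cur \<omega>"
      by (intro cur_tendsto \<omega> test_continuous \<Phi>)
    ultimately show "a = cur \<omega>" by (rule LIMSEQ_unique)
  qed
qed

lemma current_supp_cur: "current_supp cur \<subseteq> cball c r"
proof -
  have "cur \<omega> = 0" if "supp \<omega> \<subseteq> - cball c r" for \<omega>
    by (rule cur_eq_zero) (use that in_supp in blast)
  then have "- cball c r \<in> {U. open U \<and> (\<forall>\<omega>. test \<omega> \<longrightarrow> supp \<omega> \<subseteq> U \<longrightarrow> cur \<omega> = 0)}"
    by (simp add: open_Compl)
  then show ?thesis unfolding current_supp_def by blast
qed

text \<open>Passes from test forms to continuous ones on a null set \<open>V\<close>: the smooth
  approximants of the product keep their supports inside that of \<beta>, so \<open>cur\<close>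
  kills them and hence their limit.\<close>

lemma cur_localized_zero:
  fixes \<beta> :: "complex^'n \<Rightarrow> real"
  assumes \<beta>: "test \<beta>" "supp \<beta> \<subseteq> V" and V: "\<And>\<omega>. test \<omega> \<Longrightarrow> supp \<omega> \<subseteq> V \<Longrightarrow> cur \<omega> = 0"
    and \<omega>: "continuous_on UNIV \<omega>"
  shows "cur (\<lambda>z. \<beta> z *\<^sub>R \<omega> z) = 0"
proof -
  obtain \<Phi> where \<Phi>: "\<And>n. test (\<Phi> n)" "\<And>n. supp (\<Phi> n) \<subseteq> supp \<beta>"
    "uniform_limit UNIV \<Phi> (\<lambda>z. \<beta> z *\<^sub>R \<omega> z) sequentially"
    using smooth_approximation[OF \<beta>(1) \<omega>] by auto
  have "(\<lambda>n. cur (\<Phi> n)) \<longlonglongrightarrow> cur (\<lambda>z. \<beta> z *\<^sub>R \<omega> z)"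
    by (intro cur_tendsto[OF _ _ \<Phi>(3)] test_continuous[OF \<Phi>(1)] continuous_on_scaleR test_continuous[OF \<beta>(1)] \<omega>)
  moreover have "cur (\<Phi> n) = 0" for n
    by (rule V[OF \<Phi>(1) order_trans[OF \<Phi>(2) \<beta>(2)]])
  ultimately show ?thesis by (simp add: LIMSEQ_const_iff)
qed

text \<open>
  \<open>\<omega>\<close> need not be smooth, so the definition of the support does not apply directly; multiplication
  with \<open>1 - \<beta>\<close> for finitely many bumps \<open>\<beta>\<close> kills \<open>\<omega>\<close> over the ball without changing the value.
\<close>

lemma cur_zero_near_supp:
  assumes \<omega>: "continuous_on UNIV \<omega>" and U: "open U" "current_supp cur \<subseteq> U" "\<And>z. z \<in> U \<Longrightarrow> \<omega> z = 0"
  shows "cur \<omega> = 0"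
proof -
  \<comment> \<open>Vanishing is required for all continuous forms, since in the induction below
    \<beta> multiplies a form already altered by the other bumps and no smoother than
    \<omega>.\<close>
  define good where "good = (\<lambda>p e \<beta>. 0 < e \<and> test \<beta> \<and> (\<forall>z\<in>ball p e. \<beta> z = (1::real)) \<and>
    (\<forall>\<omega>. continuous_on UNIV \<omega> \<longrightarrow> cur (\<lambda>z. \<beta> z *\<^sub>R \<omega> z) = 0))"
  define Q where "Q = cball c r - U"
  have "\<exists>e \<beta>. good p e \<beta>" if "p \<in> Q" for p
  proof -
    have "p \<notin> current_supp cur" using that U(2) unfolding Q_def by blast
    then obtain V where V: "open V" "p \<in> V" "\<forall>\<omega>. test \<omega> \<longrightarrow> supp \<omega> \<subseteq> V \<longrightarrow> cur \<omega> = 0"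
      unfolding current_supp_def by auto
    then obtain e where e: "e > 0" "cball p e \<subseteq> V" using open_contains_cball by metis
    obtain \<beta> :: "complex^'n \<Rightarrow> real" where \<beta>: "test \<beta>" "supp \<beta> \<subseteq> cball p e" "\<forall>z\<in>cball p (e/2). \<beta> z = 1"
      using bump_exists[of "e/2" e p] e(1) by auto
    have "good p (e/2) \<beta>"
      unfolding good_def
    proof (intro conjI allI impI ballI)
      fix \<eta> :: "'n form11" assume "continuous_on UNIV \<eta>"
      then show "cur (\<lambda>z. \<beta> z *\<^sub>R \<eta> z) = 0"
        using V(3) e(2) \<beta>(2) by (intro cur_localized_zero[OF \<beta>(1), of V]) auto
    qed (use e \<beta> in auto)
    then show ?thesis by blast
  qed
  then obtain e \<beta> where good: "\<And>p. p \<in> Q \<Longrightarrow> good p (e p) (\<beta> p)" by metis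
  have "compact Q" unfolding Q_def by (intro compact_diff compact_cball U(1))
  then obtain F where F: "F \<subseteq> Q" "finite F" "Q \<subseteq> (\<Union>p\<in>F. ball p (e p))"
  proof (rule compactE_image[of Q Q "\<lambda>p. ball p (e p)"])
    show "Q \<subseteq> (\<Union>p\<in>Q. ball p (e p))"
      using good unfolding good_def by force
  qed auto
  have "continuous_on UNIV (\<lambda>z. (\<Prod>p\<in>F. 1 - \<beta> p z) *\<^sub>R \<omega> z) \<and>
      cur (\<lambda>z. (\<Prod>p\<in>F. 1 - \<beta> p z) *\<^sub>R \<omega> z) = cur \<omega>"
    using F(2) F(1)
  proof (induction F)
    case empty then show ?case using \<omega> by simp
  next
    case (insert p F)
    define \<eta> where "\<eta> = (\<lambda>z. (\<Prod>p\<in>F. 1 - \<beta> p z) *\<^sub>R \<omega> z)"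
    have \<eta>: "continuous_on UNIV \<eta>" "cur \<eta> = cur \<omega>"
      using insert unfolding \<eta>_def by auto
    have p: "test (\<beta> p)" "cur (\<lambda>z. \<beta> p z *\<^sub>R \<eta> z) = 0"
      using good[of p] insert.prems \<eta>(1) unfolding good_def by auto
    have c: "continuous_on UNIV (\<lambda>z. \<beta> p z *\<^sub>R \<eta> z)"
      by (intro continuous_on_scaleR test_continuous p(1) \<eta>(1))
    have eq: "(\<lambda>z. (\<Prod>p\<in>insert p F. 1 - \<beta> p z) *\<^sub>R \<omega> z) = (\<lambda>z. \<eta> z - \<beta> p z *\<^sub>R \<eta> z)"
      using insert.hyps by (auto simp: \<eta>_def algebra_simps)
    show ?case
      unfolding eq using cur_diff[OF \<eta>(1) c] p(2) \<eta>(2) continuous_on_diff[OF \<eta>(1) c] by simp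
  qed
  moreover have "cur (\<lambda>z. (\<Prod>p\<in>F. 1 - \<beta> p z) *\<^sub>R \<omega> z) = 0"
  proof (rule cur_eq_zero)
    fix z assume z: "z \<in> cball c r"
    show "(\<Prod>p\<in>F. 1 - \<beta> p z) *\<^sub>R \<omega> z = 0"
    proof (cases "z \<in> U")
      case True then show ?thesis using U(3) by simp
    next
      case False
      then obtain p where p: "p \<in> F" "z \<in> ball p (e p)" using z F(3) unfolding Q_def by auto
      then have "\<beta> p z = 1" using good[of p] F(1) unfolding good_def by auto
      then show ?thesis using p(1) F(2) by (auto simp: prod_zero_iff)
    qed
  qed
  ultimately show ?thesis by simp
qed

text \<open>For an admissible cut-off f, the forms f \<omega> and \<omega> agree near the support,
  so \<open>cur\<close> gives them the same value; one explicit cut-off then settles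
  uniqueness.\<close>

lemma current_pairing_cur:
  assumes \<omega>: "continuous_on UNIV \<omega>"
  shows "current_pairing cur \<omega> = cur \<omega>"
proof -
  have ext: "current_ext cur (scale_form f \<omega>) = cur \<omega>"
    if f: "test f" and U: "open U" "current_supp cur \<subseteq> U" "\<forall>z\<in>U. f z = 1" for f U
  proof -
    have c: "continuous_on UNIV (scale_form f \<omega>)"
      by (intro continuous_on_scale_form test_continuous f \<omega>)
    have "cur (\<lambda>z. scale_form f \<omega> z - \<omega> z) = 0"
      by (rule cur_zero_near_supp[OF continuous_on_diff[OF c \<omega>] U(1,2)])
        (use U(3) in \<open>simp add: scale_form_def vec_eq_iff\<close>)
    then show ?thesis
      using cur_diff[OF c \<omega>] current_ext_cur[OF c compact_supp_scale_form] f by (simp add: test_def)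
  qed
  \<comment> \<open>The locale fixes no sign for r, hence the absolute value. Radius r + 1 leaves an
    open neighbourhood of the closed ball on which the bump is 1.\<close>
  have "r + 1 < \<bar>r\<bar> + 2" "0 < \<bar>r\<bar> + 2" by linarith+
  from bump_exists[OF this, of c]
  obtain \<beta> :: "complex^'n \<Rightarrow> real" where \<beta>: "test \<beta>" "\<forall>z\<in>cball c (r + 1). \<beta> z = 1"
    by auto
  have sub: "current_supp cur \<subseteq> ball c (r + 1)" using current_supp_cur by force
  show ?thesis
    unfolding current_pairing_def
  proof (rule the_equality)
    show "\<forall>f. test f \<longrightarrow> (\<exists>U. open U \<and> current_supp cur \<subseteq> U \<and> (\<forall>z\<in>U. f z = 1)) \<longrightarrow>
        current_ext cur (scale_form f \<omega>) = cur \<omega>"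
      using ext by auto
  next
    fix a assume a: "\<forall>f. test f \<longrightarrow> (\<exists>U. open U \<and> current_supp cur \<subseteq> U \<and> (\<forall>z\<in>U. f z = 1)) \<longrightarrow>
        current_ext cur (scale_form f \<omega>) = a"
    have one: "\<forall>z\<in>ball c (r + 1). complex_of_real (\<beta> z) = 1" using \<beta>(2) by simp
    have "current_ext cur (scale_form (\<lambda>z. complex_of_real (\<beta> z)) \<omega>) = a"
      by (rule a[rule_format, OF test_of_real[OF \<beta>(1)]]) (use sub one in blast)
    then show "a = cur \<omega>" using ext[OF test_of_real[OF \<beta>(1)] open_ball sub one] by simp
  qed
qed

text \<open>Over S the integrand is f times the Levi form of u in a direction of \<Gamma>, a product
  of nonnegative numbers. The form is in general only continuous, so its value is read through
  \<open>current_ext\<close>.\<close>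

lemma directed_current_cur:
  assumes "\<And>p. p \<in> S \<Longrightarrow> snd p \<in> \<Gamma> (fst p)"
  shows "directed_current \<Gamma> cur"
  unfolding directed_current_def positive_distribution_def current_wedge_def
proof (intro conjI ballI allI impI positive_current11_cur)
  fix u and f :: "complex^'n \<Rightarrow> complex"
  assume u: "u \<in> P_class \<Gamma>" and f: "test f" "\<forall>z. f z \<in> \<real>\<^sub>\<ge>\<^sub>0"
  have u2: "class_C 2 u" using u unfolding P_class_def by simp
  have c: "continuous_on UNIV (scale_form f (iddbar_real u))"
    by (intro continuous_on_scale_form test_continuous f(1) continuous_on_iddbar
        class_C_bounded_linear_comp[OF bounded_linear_of_real u2])
  have "cur (scale_form f (iddbar_real u)) \<in> \<real>\<^sub>\<ge>\<^sub>0"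
  proof (rule cur_nonneg[OF c])
    fix p assume "p \<in> S"
    then show "pair11 (scale_form f (iddbar_real u) (fst p)) (snd p) \<in> \<real>\<^sub>\<ge>\<^sub>0"
      unfolding pair11_scale_form using u f(2) assms unfolding P_class_def
      by (intro nonneg_Reals_mult_I) auto
  qed
  then show "current_ext cur (scale_form f (iddbar_real u)) \<in> \<real>\<^sub>\<ge>\<^sub>0"
    using current_ext_cur[OF c compact_supp_scale_form] f(1) by (simp add: test_def)
qed

end

section \<open>Extension of functions to the class\<close>

lemma dird_cong_open:
  assumes "open U"
  shows "(\<And>z. z \<in> U \<Longrightarrow> f z = g z) \<Longrightarrow> z \<in> U \<Longrightarrow> dird vs f z = dird vs g z"
proof (induction vs arbitrary: f g z)
  case (Cons v vs)
  have "(f has_derivative F) (at y) \<longleftrightarrow> (g has_derivative F) (at y)" if y: "y \<in> U" for y F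
  proof
    show "(g has_derivative F) (at y)" if "(f has_derivative F) (at y)"
      by (rule has_derivative_transform_within_open[OF that assms y Cons.prems(1)])
    show "(f has_derivative F) (at y)" if "(g has_derivative F) (at y)"
      by (rule has_derivative_transform_within_open[OF that assms y Cons.prems(1)[symmetric]])
  qed
  then have "frechet_derivative f (at y) v = frechet_derivative g (at y) v" if "y \<in> U" for y
    using that by (simp add: frechet_derivative_def)
  then show ?case unfolding dird.simps by (rule Cons.IH[OF _ Cons.prems(2)])
qed simp

lemma levi_cong_open:
  assumes "open U" "\<And>z. z \<in> U \<Longrightarrow> f z = g z" "z \<in> U"
  shows "levi f z \<xi> = levi g z \<xi>"
proof -
  have "dird [a, b] f z = dird [a, b] g z" for a b by (rule dird_cong_open[OF assms])
  then show ?thesis unfolding levi_def by (simp only:)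
qed

section \<open>Radial functions and the correction outside the ball\<close>

lemma has_real_derivative_max_power:
  "((\<lambda>t. max 0 t ^ Suc (Suc n)) has_real_derivative of_nat (Suc (Suc n)) * max 0 t ^ Suc n) (at t)"
proof (cases t "0::real" rule: linorder_cases)
  case less
  have "((\<lambda>t. 0) has_real_derivative 0) (at t)" by simp
  then have "((\<lambda>t. max 0 t ^ Suc (Suc n)) has_real_derivative 0) (at t)"
    by (rule has_field_derivative_transform_within_open[of _ _ _ "{..<0}"]) (use less in auto)
  then show ?thesis using less by simp
next
  case greater
  have "((\<lambda>t. t ^ Suc (Suc n)) has_real_derivative of_nat (Suc (Suc n)) * t ^ Suc n) (at t)"
    using DERIV_pow[of "Suc (Suc n)" t] by simp
  then have "((\<lambda>t. max 0 t ^ Suc (Suc n)) has_real_derivative of_nat (Suc (Suc n)) * t ^ Suc n) (at t)"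
    by (rule has_field_derivative_transform_within_open[of _ _ _ "{0<..}"]) (use greater in auto)
  then show ?thesis using greater by simp
next
  case equal
  \<comment> \<open>Caratheodory's criterion at 0: the function factors as z times this continuous
    slope, which vanishes at 0.\<close>
  have "isCont (\<lambda>z::real. max 0 z ^ Suc n) 0" by (intro continuous_intros)
  then show ?thesis
    unfolding CARAT_DERIV equal
    by (intro exI[of _ "\<lambda>z. max 0 z ^ Suc n"]) (simp add: max_def)
qed

context
  fixes D :: "nat \<Rightarrow> real \<Rightarrow> real" and c :: "complex^'n::finite"
  assumes D: "\<And>t. (D 0 has_real_derivative D 1 t) (at t)" "\<And>t. (D 1 has_real_derivative D 2 t) (at t)"
    and cont: "continuous_on UNIV (D 2)"
begin

lemma class_C_radial: "class_C 2 (\<lambda>z. D 0 ((z - c) \<bullet> (z - c)))"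
proof (rule class_C_compose_real[where D = D and q = "\<lambda>z. (z - c) \<bullet> (z - c)"])
  show "class_C 2 (\<lambda>z. (z - c) \<bullet> (z - c))"
    by (intro class_C_inner class_C_diff class_C_ident class_C_const)
  fix n t assume "n < (2::nat)"
  then have "n = 0 \<or> n = 1" by auto
  then show "(D n has_real_derivative D (Suc n) t) (at t)"
    using D[of t] by (auto simp: numeral_2_eq_2)
qed (rule cont)

lemma dird_radial:
  "dird [v, w] (\<lambda>z. D 0 ((z - c) \<bullet> (z - c))) z =
    4 * D 2 ((z - c) \<bullet> (z - c)) * ((z - c) \<bullet> v) * ((z - c) \<bullet> w) + 2 * D 1 ((z - c) \<bullet> (z - c)) * (v \<bullet> w)"
proof -
  have q: "((\<lambda>z. (z - c) \<bullet> (z - c)) has_derivative (\<lambda>v. 2 * ((y - c) \<bullet> v))) (at y)" for y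
    by (auto intro!: derivative_eq_intros simp: inner_commute)
  have comp: "((\<lambda>z. F ((z - c) \<bullet> (z - c))) has_derivative (\<lambda>v. F' * (2 * ((y - c) \<bullet> v)))) (at y)"
    if "(F has_real_derivative F') (at ((y - c) \<bullet> (y - c)))" for F F' y
    using has_derivative_compose[OF q that[unfolded has_field_derivative_def]] .
  have 1: "frechet_derivative (\<lambda>z. D 0 ((z - c) \<bullet> (z - c))) (at y) v = D 1 ((y - c) \<bullet> (y - c)) * (2 * ((y - c) \<bullet> v))" for y
    using frechet_derivative_at[OF comp[OF D(1)]] by metis
  have "((\<lambda>y. 2 * ((y - c) \<bullet> v)) has_derivative (\<lambda>w. 2 * (w \<bullet> v))) (at z)"
    by (auto intro!: derivative_eq_intros)
  from has_derivative_mult[OF comp[OF D(2)] this]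
  have "((\<lambda>y. D 1 ((y - c) \<bullet> (y - c)) * (2 * ((y - c) \<bullet> v))) has_derivative
    (\<lambda>w. D 1 ((z - c) \<bullet> (z - c)) * (2 * (w \<bullet> v)) + D 2 ((z - c) \<bullet> (z - c)) * (2 * ((z - c) \<bullet> w)) * (2 * ((z - c) \<bullet> v)))) (at z)" .
  from frechet_derivative_at[OF this, symmetric] show ?thesis
    by (simp add: 1 inner_commute)
qed

text \<open>The second-order chain rule for q = |z - c|^2, whose Levi form is |\<xi>|^2. The bracket
  is the squared modulus of the hermitian product of \<xi> and z - c, so \<open>D 2\<close> \<ge> 0
  leaves \<open>D 1\<close> times |\<xi>|^2 as a lower bound.\<close>

lemma levi_radial:
  "levi (\<lambda>z. D 0 ((z - c) \<bullet> (z - c))) z \<xi> =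
    D 2 ((z - c) \<bullet> (z - c)) * (((z - c) \<bullet> \<xi>)\<^sup>2 + ((z - c) \<bullet> (\<i> *s \<xi>))\<^sup>2) + D 1 ((z - c) \<bullet> (z - c)) * (norm \<xi>)\<^sup>2"
proof -
  have i: "(\<i> *s \<xi>) \<bullet> (\<i> *s \<xi>) = \<xi> \<bullet> \<xi>"
    by (simp add: inner_vec_def inner_complex_def add.commute)
  show ?thesis
    unfolding levi_def dird_radial i power2_norm_eq_inner by (simp add: power2_eq_square field_simps)
qed

end

lemma levi_scaleR:
  fixes u :: "complex^'n::finite \<Rightarrow> real"
  assumes "class_C 2 u"
  shows "levi u z (t *\<^sub>R \<xi>) = t\<^sup>2 * levi u z \<xi>"
  using pair11_scaleR[of "iddbar_real u z" t \<xi>] unfolding pair11_iddbar_real[OF assms]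
  by (metis of_real_eq_iff of_real_mult of_real_power)

lemma P_class_iff:
  "u \<in> P_class \<Gamma> \<longleftrightarrow> class_C 2 u \<and> (\<forall>z. \<forall>\<xi>\<in>\<Gamma> z. 0 \<le> levi u z \<xi>)"
  unfolding P_class_def by (auto simp: pair11_iddbar_real)

text \<open>The coefficients of \<open>iddbar_real w\<close> are bounded on the compact ball, and w
  vanishes identically on the open complement.\<close>

lemma levi_bound:
  fixes w :: "complex^'n::finite \<Rightarrow> real"
  assumes w: "class_C 2 w" and sub: "supp w \<subseteq> cball c R"
  obtains C where "0 \<le> C" "\<And>z \<xi>. \<bar>levi w z \<xi>\<bar> \<le> C * (norm \<xi>)\<^sup>2"
proof -
  have "continuous_on (cball c R) (iddbar_real w)"
    by (intro continuous_on_iddbar class_C_bounded_linear_comp[OF bounded_linear_of_real w])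
  then have "bounded (iddbar_real w ` cball c R)"
    by (intro compact_imp_bounded compact_continuous_image compact_cball)
  then obtain M where M: "0 < M" "\<And>z. z \<in> cball c R \<Longrightarrow> norm (iddbar_real w z) \<le> M"
    unfolding bounded_pos by blast
  define C where "C = (real CARD('n))\<^sup>2 * M"
  have "0 \<le> C" unfolding C_def using M(1) by simp
  moreover have "\<bar>levi w z \<xi>\<bar> \<le> C * (norm \<xi>)\<^sup>2" for z \<xi>
  proof (cases "z \<in> cball c R")
    case True
    have "\<bar>levi w z \<xi>\<bar> = norm (pair11 (iddbar_real w z) \<xi>)"
      unfolding pair11_iddbar_real[OF w] by simp
    also have "\<dots> \<le> (real CARD('n))\<^sup>2 * norm (iddbar_real w z) * (norm \<xi>)\<^sup>2" by (rule norm_pair11_le)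
    also have "\<dots> \<le> C * (norm \<xi>)\<^sup>2"
      unfolding C_def by (intro mult_right_mono mult_left_mono M(2) True) auto
    finally show ?thesis .
  next
    case False
    have "levi w z \<xi> = levi (\<lambda>_. 0) z \<xi>"
    proof (rule levi_cong_open[of "- cball c R"])
      show "w y = 0" if "y \<in> - cball c R" for y using that sub in_supp[of w y] by blast
    qed (use False in \<open>auto simp: open_Compl\<close>)
    also have "\<dots> = 0"
      using levi_bounded_linear_comp[OF bounded_linear_zero w, of z \<xi>] .
    finally show ?thesis using \<open>0 \<le> C\<close> by simp
  qed
  ultimately show ?thesis by (rule that)
qed

text \<open>
  Outside the ball, the failure of \<open>u\<close> to lie in the class is compensated by a multiple of a convex
  function of \<open>|z - c|\<^sup>2\<close> that vanishes on a smaller ball.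
\<close>

lemma P_class_extension:
  fixes u :: "complex^'n::finite \<Rightarrow> real"
  assumes cone: "\<And>z. cone (\<Gamma> z)" and u: "class_C 2 u"
    and pos: "\<And>z \<xi>. z \<in> cball c r \<Longrightarrow> \<xi> \<in> \<Gamma> z \<Longrightarrow> norm \<xi> = 1 \<Longrightarrow> 0 \<le> levi u z \<xi>"
    and a: "a < r\<^sup>2" and r: "0 < r"
  shows "\<exists>v\<in>P_class \<Gamma>. \<forall>z. (z - c) \<bullet> (z - c) \<le> a \<longrightarrow> v z = u z"
proof -
  define q where "q = (\<lambda>z. (z - c) \<bullet> (z - c))"
  have q: "q z = (dist c z)\<^sup>2" for z
    unfolding q_def by (simp add: dot_square_norm dist_norm norm_minus_commute)
  \<comment> \<open>The bump is 1 on a neighbourhood of the closed ball of radius r, so cutting off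
    does not change the Levi form there, boundary included.\<close>
  obtain \<beta> :: "complex^'n \<Rightarrow> real" where \<beta>: "test \<beta>" "supp \<beta> \<subseteq> cball c (r + 2)" "\<forall>z\<in>cball c (r + 1). \<beta> z = 1"
    using bump_exists[of "r + 1" "r + 2" c] r by auto
  define w where "w = (\<lambda>z. \<beta> z * u z)"
  have w: "class_C 2 w" unfolding w_def using \<beta>(1) u by (intro class_C_mult) (simp add: test_def)
  have nz: "z \<in> cball c (r + 2)" if "w z \<noteq> 0" for z
    using that by (intro subsetD[OF \<beta>(2)] in_supp) (simp add: w_def)
  have "supp w \<subseteq> cball c (r + 2)"
    by (rule supp_subset[OF closed_cball nz])
  from levi_bound[OF w this] obtain C where C: "0 \<le> C" "\<And>z \<xi>. \<bar>levi w z \<xi>\<bar> \<le> C * (norm \<xi>)\<^sup>2" by blast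
  \<comment> \<open>Outside the ball q - a \<ge> r^2 - a > 0, so the derivative 3 A (q - a)^2 of the
    correction is at least C, which absorbs the worst Levi form of w.\<close>
  define A where "A = C / (3 * (r\<^sup>2 - a)\<^sup>2)"
  have A: "0 \<le> A" unfolding A_def using C(1) by simp
  \<comment> \<open>The correction and its first two derivatives. The cube is the lowest integer
    power of the positive part that is of class C^2.\<close>
  define D :: "nat \<Rightarrow> real \<Rightarrow> real" where
    "D = (\<lambda>n t. if n = 0 then A * max 0 (t - a) ^ 3 else if n = 1 then A * (3 * max 0 (t - a) ^ 2) else A * (6 * max 0 (t - a)))"
  have shift: "((\<lambda>t. t - a) has_real_derivative 1) (at t)" for t by (auto intro!: derivative_eq_intros)
  have max3: "((\<lambda>t. max 0 (t - a) ^ 3) has_real_derivative 3 * (max 0 (t - a))\<^sup>2) (at t)" for t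
    using DERIV_chain2[OF has_real_derivative_max_power[of 1] shift, of t] by (simp add: eval_nat_numeral)
  have max2: "((\<lambda>t. (max 0 (t - a))\<^sup>2) has_real_derivative 2 * max 0 (t - a)) (at t)" for t
    using DERIV_chain2[OF has_real_derivative_max_power[of 0] shift, of t] by (simp add: eval_nat_numeral)
  have D: "(D 0 has_real_derivative D 1 t) (at t)" "(D 1 has_real_derivative D 2 t) (at t)" for t
    using DERIV_cmult[OF max3, of A t] DERIV_cmult[OF DERIV_cmult[OF max2, of 3], of A t]
    by (simp_all add: D_def)
  have cont: "continuous_on UNIV (D 2)"
    unfolding D_def by (auto intro!: continuous_intros)
  define H where "H = (\<lambda>z. D 0 (q z))"
  have H: "class_C 2 H" unfolding H_def q_def by (rule class_C_radial[OF D cont])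
  have D2: "0 \<le> D 2 t" for t unfolding D_def using A by simp
  have leviH: "D 1 (q z) * (norm \<xi>)\<^sup>2 \<le> levi H z \<xi>" for z \<xi>
    unfolding H_def q_def levi_radial[OF D cont] using D2 by simp
  define v where "v = (\<lambda>z. w z + H z)"
  have "0 \<le> levi v z \<xi>" if \<xi>: "\<xi> \<in> \<Gamma> z" for z \<xi>
  proof (cases "z \<in> cball c r")
    case True
    have "levi w z \<xi> = levi u z \<xi>"
      by (rule levi_cong_open[of "ball c (r + 1)"]) (use True \<beta>(3) in \<open>auto simp: w_def\<close>)
    moreover have "0 \<le> levi u z \<xi>"
    proof (cases "\<xi> = 0")
      case True then show ?thesis using levi_scaleR[OF u, of z 0 \<xi>] by simp
    next
      case False
      \<comment> \<open>The hypothesis covers unit vectors only; cones are stable under this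
        rescaling and the Levi form is quadratic under it.\<close>
      have "(1 / norm \<xi>) *\<^sub>R \<xi> \<in> \<Gamma> z" using cone[of z] \<xi> unfolding cone_def by simp
      then have "0 \<le> levi u z ((1 / norm \<xi>) *\<^sub>R \<xi>)" using pos[OF True] False by simp
      then have "0 \<le> (norm \<xi>)\<^sup>2 * levi u z ((1 / norm \<xi>) *\<^sub>R \<xi>)" by simp
      also have "\<dots> = levi u z \<xi>"
        unfolding levi_scaleR[OF u, symmetric] using False by simp
      finally show ?thesis .
    qed
    moreover have "0 \<le> D 1 (q z) * (norm \<xi>)\<^sup>2" unfolding D_def using A by simp
    ultimately show ?thesis using leviH[of z \<xi>] by (simp add: v_def levi_add[OF w H])
  next
    case False
    then have "r\<^sup>2 \<le> q z" unfolding q using r by (intro power_mono) auto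
    then have "(r\<^sup>2 - a)\<^sup>2 \<le> (max 0 (q z - a))\<^sup>2" using a by (intro power_mono) auto
    then have "A * (3 * (r\<^sup>2 - a)\<^sup>2) \<le> D 1 (q z)" unfolding D_def using A by (simp only: if_True if_False one_neq_zero simp_thms) (intro mult_left_mono, auto)
    moreover have "A * (3 * (r\<^sup>2 - a)\<^sup>2) = C" unfolding A_def using a by simp
    ultimately have "C * (norm \<xi>)\<^sup>2 \<le> D 1 (q z) * (norm \<xi>)\<^sup>2" by (intro mult_right_mono) auto
    then show ?thesis using leviH[of z \<xi>] C(2)[of z \<xi>] by (simp add: v_def levi_add[OF w H])
  qed
  moreover have "class_C 2 v" unfolding v_def by (rule class_C_add[OF w H])
  moreover have "v z = u z" if "q z \<le> a" for z
  proof -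
    have "(dist c z)\<^sup>2 \<le> r\<^sup>2" using order_trans[OF that less_imp_le[OF a]] unfolding q .
    then have "dist c z \<le> r" by (rule power2_le_imp_le) (use r in simp)
    then show ?thesis using that \<beta>(3) by (simp add: v_def w_def H_def D_def)
  qed
  ultimately show ?thesis by (intro bexI[of _ v]) (auto simp: P_class_iff q_def)
qed

section \<open>Jensen measures\<close>

lemma jensen_AE:
  assumes "jensen_measure \<Gamma> K x \<mu>" "compact K"
  shows "AE z in \<mu>. z \<in> K"
proof (rule AE_I[of _ _ "- K"])
  have s: "sets \<mu> = sets borel" using assms(1) by (simp add: jensen_measure_def)
  show "emeasure \<mu> (- K) = 0" using assms(1) by (simp add: jensen_measure_def)
  show "- K \<in> sets \<mu>" unfolding s using compact_imp_closed[OF assms(2)] by (intro borel_open) (simp add: open_Compl)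
qed auto

lemma jensen_integrable:
  fixes f :: "complex^'n::finite \<Rightarrow> 'b::{banach, second_countable_topology}"
  assumes j: "jensen_measure \<Gamma> K x \<mu>" and K: "compact K" and f: "continuous_on UNIV f"
  shows "integrable \<mu> f"
proof -
  have p: "prob_space \<mu>" and s: "sets \<mu> = sets borel" using j by (simp_all add: jensen_measure_def)
  have "compact (f ` K)" by (rule compact_continuous_image[OF continuous_on_subset[OF f] K]) simp
  then have "bounded (f ` K)" by (rule compact_imp_bounded)
  then obtain B where B: "\<forall>z\<in>K. norm (f z) \<le> B" unfolding bounded_iff by auto
  have "f \<in> borel_measurable \<mu>"
    using borel_measurable_continuous_onI[OF f] by (simp add: measurable_cong_sets[OF s refl])
  moreover have "AE z in \<mu>. norm (f z) \<le> B"
    using jensen_AE[OF j K] by eventually_elim (use B in simp)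
  ultimately show ?thesis
    by (rule finite_measure.integrable_const_bound[OF prob_space.finite_measure[OF p], rotated])
qed

lemma levi_normsq: "levi (\<lambda>z. (z - c) \<bullet> (z - c)) z \<xi> = (norm \<xi>)\<^sup>2"
  and class_C_normsq: "class_C 2 (\<lambda>z. (z - c) \<bullet> (z - c))"
  for c :: "complex^'n::finite"
proof -
  define D :: "nat \<Rightarrow> real \<Rightarrow> real" where "D = (\<lambda>n t. if n = 0 then t else if n = 1 then 1 else 0)"
  have D: "(D 0 has_real_derivative D 1 t) (at t)" "(D 1 has_real_derivative D 2 t) (at t)" for t
    unfolding D_def by (auto intro!: derivative_eq_intros)
  have cont: "continuous_on UNIV (D 2)" by (simp add: D_def)
  show "levi (\<lambda>z. (z - c) \<bullet> (z - c)) z \<xi> = (norm \<xi>)\<^sup>2"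
    using levi_radial[OF D cont, of c z \<xi>] by (simp add: D_def)
  show "class_C 2 (\<lambda>z. (z - c) \<bullet> (z - c))"
    using class_C_radial[OF D cont, of c] by (simp add: D_def)
qed

text \<open>|z - c|^2 has Levi form |\<xi>|^2 and so lies in the class for every \<Gamma>; the hull
  condition bounds it at x by its maximum over K, which is below r^2 as K is a compact subset of the
  open ball.\<close>

lemma hull_in_sublevel:
  fixes \<Gamma> :: "complex^'n::finite \<Rightarrow> (complex^'n) set"
  assumes x: "x \<in> hull_P \<Gamma> K" and K: "compact K" "K \<subseteq> ball c r"
  shows "\<exists>a. 0 < r \<and> a < r\<^sup>2 \<and> (x - c) \<bullet> (x - c) \<le> a \<and> (\<forall>z\<in>K. (z - c) \<bullet> (z - c) \<le> a)"
proof -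
  define q where "q = (\<lambda>z. (z - c) \<bullet> (z - c))"
  have "q \<in> P_class \<Gamma>"
    unfolding q_def P_class_iff by (simp add: levi_normsq class_C_normsq)
  then have le: "ereal (q x) \<le> (SUP w\<in>K. ereal (q w))" using x by (simp add: hull_P_def)
  \<comment> \<open>Over the empty set the supremum is minus infinity, which cannot dominate a real
    value.\<close>
  then have "K \<noteq> {}" by (auto simp: bot_ereal_def)
  moreover have "continuous_on K q" unfolding q_def by (intro continuous_intros)
  ultimately obtain k where k: "k \<in> K" "\<forall>z\<in>K. q z \<le> q k"
    using continuous_attains_sup[OF K(1)] by blast
  have "(SUP w\<in>K. ereal (q w)) \<le> ereal (q k)" by (rule SUP_least) (use k in simp)
  from order_trans[OF le this] have "q x \<le> q k" by simp
  moreover have dk: "dist c k < r" using k(1) K(2) by auto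
  moreover have "q k < r\<^sup>2"
  proof -
    have "q k = (dist c k)\<^sup>2"
      unfolding q_def by (simp add: dot_square_norm dist_norm norm_minus_commute)
    also have "\<dots> < r\<^sup>2" using dk by (intro power_strict_mono) auto
    finally show ?thesis .
  qed
  moreover have "0 < r" using dk zero_le_dist[of c k] by linarith
  ultimately show ?thesis using k(2) unfolding q_def by blast
qed

text \<open>u is replaced by a member of the class that agrees with it at x and on K, hence almost
  everywhere for \<mu>. This is the positivity of the functional to be extended.\<close>

lemma jensen_inequality_on_ball:
  fixes u :: "complex^'n::finite \<Rightarrow> real"
  assumes \<Gamma>: "cone_field \<Gamma>" and K: "compact K" "K \<subseteq> ball c r"
    and x: "x \<in> hull_P \<Gamma> K" and j: "jensen_measure \<Gamma> K x \<mu>"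
    and u: "class_C 2 u"
    and pos: "\<And>z \<xi>. z \<in> cball c r \<Longrightarrow> \<xi> \<in> \<Gamma> z \<Longrightarrow> norm \<xi> = 1 \<Longrightarrow> 0 \<le> levi u z \<xi>"
  shows "u x \<le> (LINT z|\<mu>. u z)"
proof -
  obtain a where a: "0 < r" "a < r\<^sup>2" "(x - c) \<bullet> (x - c) \<le> a" "\<forall>z\<in>K. (z - c) \<bullet> (z - c) \<le> a"
    using hull_in_sublevel[OF x K] by blast
  have cone: "cone (\<Gamma> z)" for z using \<Gamma> by (simp add: cone_field_def)
  have "\<exists>v\<in>P_class \<Gamma>. \<forall>z. (z - c) \<bullet> (z - c) \<le> a \<longrightarrow> v z = u z"
    by (rule P_class_extension[OF cone u _ a(2,1)]) (rule pos)
  then obtain v where v: "v \<in> P_class \<Gamma>" "\<forall>z. (z - c) \<bullet> (z - c) \<le> a \<longrightarrow> v z = u z" by blast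
  have v2: "class_C 2 v" using v(1) by (simp add: P_class_def)
  have "u x = v x" using v(2) a(3) by simp
  also have "\<dots> \<le> (LINT z|\<mu>. v z)" using j v(1) by (simp add: jensen_measure_def)
  also have "\<dots> = (LINT z|\<mu>. u z)"
  proof (rule integral_cong_AE)
    show "AE z in \<mu>. v z = u z" using jensen_AE[OF j K(1)] by eventually_elim (use v(2) a(4) in simp)
  qed (intro borel_measurable_integrable jensen_integrable[OF j K(1)] class_C_continuous[OF u] class_C_continuous[OF v2])+
  finally show ?thesis .
qed

theorem theorem3p4:
  fixes \<Gamma> :: "complex^'n::finite \<Rightarrow> (complex^'n) set"
    and K :: "(complex^'n) set"
    and c x :: "complex^'n"
    and r :: real
    and \<mu> :: "(complex^'n) measure"
  assumes "cone_field \<Gamma>"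
    and "compact K"
    and "K \<subseteq> ball c r"
    and "x \<in> hull_P \<Gamma> K"
    and "jensen_measure \<Gamma> K x \<mu>"
  shows "\<exists>T. positive_current11 T \<and> directed_current \<Gamma> T \<and>
           current_supp T \<subseteq> closure (ball c r) \<and>
           (\<forall>f. test f \<longrightarrow>
              iddbar_current T f = (LINT z|\<mu>. f z) - (LINT z|return borel x. f z)) \<and>
           (\<forall>\<phi>\<in>P_class \<Gamma>.
              complex_of_real (LINT z|\<mu>. \<phi> z) =
                complex_of_real (\<phi> x) + current_pairing T (iddbar_real \<phi>))"
proof -
  note int = jensen_integrable[OF assms(5,2)]
  have r: "0 < r" using hull_in_sublevel[OF assms(4,2,3)] by blast
  define S where "S = {p. fst p \<in> cball c r \<and> snd p \<in> \<Gamma> (fst p) \<and> norm (snd p) = 1}"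
  define L where "L = (\<lambda>(u :: complex^'n \<Rightarrow> real) p. levi u (fst p) (snd p))"
  define gap where "gap = (\<lambda>u :: complex^'n \<Rightarrow> real. (LINT z|\<mu>. u z) - u x)"
  define G0 where "G0 = (\<lambda>u. (L u, gap u)) ` {u. class_C 2 u}"
  have G0I: "(g, a) \<in> G0" if "class_C 2 u" "g = L u" "a = gap u" for g a u
    unfolding G0_def by (rule image_eqI[of _ _ u]) (use that in simp_all)
  have G0: "positive_graph S G0"
    unfolding positive_graph_def
  proof (intro conjI allI impI)
    fix g a h b assume "(g, a) \<in> G0" "(h, b) \<in> G0"
    then obtain u v where uv: "class_C 2 u" "g = L u" "a = gap u" "class_C 2 v" "h = L v" "b = gap v"
      by (auto simp: G0_def)
    show "((\<lambda>p. g p + h p), a + b) \<in> G0"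
    proof (rule G0I[OF class_C_add[OF uv(1,4)]])
      show "(\<lambda>p. g p + h p) = L (\<lambda>z. u z + v z)" by (simp add: uv L_def levi_add)
      show "a + b = gap (\<lambda>z. u z + v z)"
        unfolding uv gap_def Bochner_Integration.integral_add[OF int[OF class_C_continuous[OF uv(1)]] int[OF class_C_continuous[OF uv(4)]]]
        by simp
    qed
  next
    fix t g a assume "(g, a) \<in> G0"
    then obtain u where u: "class_C 2 u" "g = L u" "a = gap u" by (auto simp: G0_def)
    show "((\<lambda>p. t * g p), t * a) \<in> G0"
    proof (rule G0I[OF class_C_bounded_linear_comp[OF bounded_linear_mult_right u(1)]])
      show "(\<lambda>p. t * g p) = L (\<lambda>z. t * u z)"
        unfolding u L_def levi_bounded_linear_comp[OF bounded_linear_mult_right u(1)] by (rule refl)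
      show "t * a = gap (\<lambda>z. t * u z)" by (simp add: u gap_def algebra_simps)
    qed
  next
    fix g a assume "(g, a) \<in> G0" and pos: "\<forall>p\<in>S. 0 \<le> g p"
    then obtain u where u: "class_C 2 u" "g = L u" "a = gap u" by (auto simp: G0_def)
    have "u x \<le> (LINT z|\<mu>. u z)"
    proof (rule jensen_inequality_on_ball[OF assms(1-5) u(1)])
      show "0 \<le> levi u z \<xi>" if "z \<in> cball c r" "\<xi> \<in> \<Gamma> z" "norm \<xi> = 1" for z \<xi>
        using pos[rule_format, of "(z, \<xi>)"] that by (simp add: S_def u L_def)
    qed
    then show "0 \<le> a" by (simp add: u gap_def)
  qed
  have e: "(L (\<lambda>z. (z - c) \<bullet> (z - c)), gap (\<lambda>z. (z - c) \<bullet> (z - c))) \<in> G0"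
    by (rule G0I[OF class_C_normsq refl refl])
  have e1: "L (\<lambda>z. (z - c) \<bullet> (z - c)) p = 1" if "p \<in> S" for p
    using that by (simp add: L_def levi_normsq S_def)
  obtain \<Lambda> where pos: "positive_functional S \<Lambda>" and \<Lambda>: "\<forall>g a. (g, a) \<in> G0 \<longrightarrow> \<Lambda> g = a"
    using positive_functional_extension[OF G0 e] e1 by auto
  interpret positive_functional S \<Lambda> by (rule pos)
  interpret averaged_current S \<Lambda> c r
    by unfold_locales (simp_all add: S_def)
  have \<Lambda>_levi: "\<Lambda> (\<lambda>p. levi u (fst p) (snd p)) = gap u" if "class_C 2 u" for u
    using \<Lambda>[rule_format, OF G0I[OF that refl refl]] by (simp add: L_def)
  \<comment> \<open>One identity for all complex C^2 functions. It gives the equation for the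
    current when f is a test function and Jensen's formula when f is a member of the class, without
    any regularisation.\<close>
  have cur_iddbar: "cur (iddbar f) = Complex (gap (\<lambda>z. Re (f z))) (gap (\<lambda>z. Im (f z)))" if f: "class_C 2 f" for f
    unfolding cur_def pair11_iddbar[OF f]
      levi_bounded_linear_comp[OF bounded_linear_Re f, symmetric]
      levi_bounded_linear_comp[OF bounded_linear_Im f, symmetric]
      \<Lambda>_levi[OF class_C_bounded_linear_comp[OF bounded_linear_Re f]]
      \<Lambda>_levi[OF class_C_bounded_linear_comp[OF bounded_linear_Im f]] ..
  show ?thesis
  proof (intro exI[of _ cur] conjI allI impI ballI)
    show "positive_current11 cur" by (rule positive_current11_cur)
    show "directed_current \<Gamma> cur" by (rule directed_current_cur) (simp add: S_def)
    show "current_supp cur \<subseteq> closure (ball c r)" using current_supp_cur r by simp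
  next
    fix f :: "complex^'n \<Rightarrow> complex" assume f: "test f"
    have f2: "class_C 2 f" using f by (simp add: test_def)
    have i: "integrable \<mu> f" by (rule int[OF test_continuous[OF f]])
    have "f \<in> borel_measurable borel" by (rule borel_measurable_continuous_onI[OF test_continuous[OF f]])
    then have "(LINT z|return borel x. f z) = f x" by (intro integral_return) auto
    then show "iddbar_current cur f = (LINT z|\<mu>. f z) - (LINT z|return borel x. f z)"
      unfolding iddbar_current_def cur_iddbar[OF f2] gap_def
      using i by (simp add: complex_eq_iff)
  next
    fix \<phi> assume "\<phi> \<in> P_class \<Gamma>"
    then have \<phi>: "class_C 2 \<phi>" by (simp add: P_class_def)
    have c: "class_C 2 (\<lambda>z. complex_of_real (\<phi> z))"
      by (rule class_C_bounded_linear_comp[OF bounded_linear_of_real \<phi>])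
    show "complex_of_real (LINT z|\<mu>. \<phi> z) = complex_of_real (\<phi> x) + current_pairing cur (iddbar_real \<phi>)"
      unfolding current_pairing_cur[OF continuous_on_iddbar[OF c]] cur_iddbar[OF c]
      by (simp add: gap_def complex_eq_iff)
  qed
qed

end
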